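(* Let $L>0$, $\mathcal{M}>0$ and $k\in\mathbb{R}$. If $$\mathcal{M}L<\frac12\qquad\text{and}\qquad k^2\ge\frac{1+2\mathcal{M}L}{1-2\mathcal{M}L},$$ then the closed loop system $$(\delta_+)_t+(\delta_+)_x+\mathcal{M}\,\delta_-=0,\qquad (\delta_-)_t-(\delta_-)_x+\mathcal{M}\,\delta_+=0\qquad (t\ge0,\ x\in(0,L)),$$ $$\delta_+(t,0)=k\,\delta_-(t,0),\qquad \delta_-(t,L)=\delta_+(t,L)\qquad (t\ge0)$$ is unstable for all (nonzero) initial states $(\delta_+(0,\cdot),\delta_-(0,\cdot))\in(H^1(0,L))^2$.
   Context: The unknowns $\delta_+,\delta_-$ are real-valued functions of $t\ge0$ and $x\in(0,L)$; solutions are understood in the usual weak ($L^2$) sense if the initial state is not compatible with the boundary conditions. "Unstable for an initial state" means that the corresponding solution does not decay to zero, i.e. $\|(\delta_+(t,\cdot),\delta_-(t,\cdot))\|_{(L^2(0,L))^2}$ does not converge to $0$ as $t\to\infty$. *)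

theory Defs
  imports "HOL-Analysis.Analysis"
begin

text \<open>Elements of \<open>L\<^sup>2(0,L)\<close> are represented by functions on the reals; only their values
  almost everywhere on \<open>(0,L)\<close> matter.\<close>

definition L2 :: "real \<Rightarrow> (real \<Rightarrow> real) \<Rightarrow> bool" where
  "L2 L f \<longleftrightarrow> f \<in> borel_measurable (lebesgue_on {0<..<L}) \<and>
     integrable (lebesgue_on {0<..<L}) (\<lambda>x. (f x)\<^sup>2)"

definition L2_inner :: "real \<Rightarrow> (real \<Rightarrow> real) \<Rightarrow> (real \<Rightarrow> real) \<Rightarrow> real" where
  "L2_inner L f g = integral\<^sup>L (lebesgue_on {0<..<L}) (\<lambda>x. f x * g x)"

definition L2_norm2 :: "real \<Rightarrow> (real \<Rightarrow> real) \<Rightarrow> (real \<Rightarrow> real) \<Rightarrow> real" where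
  "L2_norm2 L f g = sqrt (integral\<^sup>L (lebesgue_on {0<..<L}) (\<lambda>x. (f x)\<^sup>2 + (g x)\<^sup>2))"

text \<open>The Sobolev space \<open>H\<^sup>1(0,L)\<close>: the function and its weak derivative \<open>g\<close> (tested against
  \<open>C\<^sup>1\<close> functions with compact support in \<open>(0,L)\<close>) are in \<open>L\<^sup>2(0,L)\<close>.\<close>

definition H1 :: "real \<Rightarrow> (real \<Rightarrow> real) \<Rightarrow> bool" where
  "H1 L f \<longleftrightarrow> L2 L f \<and>
     (\<exists>g. L2 L g \<and>
       (\<forall>\<phi> \<phi>'. (\<forall>x. (\<phi> has_real_derivative \<phi>' x) (at x)) \<and> continuous_on UNIV \<phi>' \<and>
               closure {x. \<phi> x \<noteq> 0} \<subseteq> {0<..<L} \<longrightarrow>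
          L2_inner L f \<phi>' = - L2_inner L g \<phi>))"

text \<open>\<open>\<phi>\<close> is \<open>C\<^sup>1\<close> on the closed rectangle \<open>[0,T] \<times> [0,L]\<close>, with partial derivatives \<open>\<phi>t\<close>
  (time) and \<open>\<phi>x\<close> (space); at the edges they are one-sided.\<close>

definition C1_rect ::
  "real \<Rightarrow> real \<Rightarrow> (real \<Rightarrow> real \<Rightarrow> real) \<Rightarrow> (real \<Rightarrow> real \<Rightarrow> real) \<Rightarrow> (real \<Rightarrow> real \<Rightarrow> real) \<Rightarrow> bool"
where
  "C1_rect T L \<phi> \<phi>t \<phi>x \<longleftrightarrow>
     (\<forall>t\<in>{0..T}. \<forall>x\<in>{0..L}.
        ((\<lambda>z. \<phi> (fst z) (snd z)) has_derivative (\<lambda>h. \<phi>t t x * fst h + \<phi>x t x * snd h))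
          (at (t, x) within {0..T} \<times> {0..L})) \<and>
     continuous_on ({0..T} \<times> {0..L}) (\<lambda>z. \<phi>t (fst z) (snd z)) \<and>
     continuous_on ({0..T} \<times> {0..L}) (\<lambda>z. \<phi>x (fst z) (snd z))"

text \<open>Weak (\<open>L\<^sup>2\<close>) solutions of the closed loop system
  \<^item> \<open>p\<^sub>t + p\<^sub>x + M q = 0\<close>, \<open>q\<^sub>t - q\<^sub>x + M p = 0\<close> on \<open>(0,L)\<close>,
  \<^item> \<open>p(t,0) = k q(t,0)\<close>, \<open>q(t,L) = p(t,L)\<close>,
  \<^item> \<open>p(0,x) = p0(x)\<close>, \<open>q(0,x) = q0(x)\<close>,

  that is, \<open>(p,q) \<in> C([0,\<infinity>); L\<^sup>2(0,L)\<^sup>2)\<close> with the integral identity obtained by multiplying the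
  equations by \<open>(\<phi>,\<psi>)\<close> and integrating by parts over \<open>[0,T] \<times> [0,L]\<close>. The boundary terms that
  arise are \<open>p(t,L) (\<psi>(t,L) - \<phi>(t,L)) + q(t,0) (k \<phi>(t,0) - \<psi>(t,0))\<close> after inserting the
  boundary conditions, so they vanish for test functions satisfying the adjoint boundary
  conditions \<open>\<phi>(t,L) = \<psi>(t,L)\<close> and \<open>\<psi>(t,0) = k \<phi>(t,0)\<close>. The space-time integral is an
  iterated one because representatives of \<open>p(t,\<cdot>)\<close> may be chosen independently for each \<open>t\<close>; the
  inner integral is continuous in \<open>t\<close>.\<close>

definition weak_solution ::
  "real \<Rightarrow> real \<Rightarrow> real \<Rightarrow> (real \<Rightarrow> real) \<Rightarrow> (real \<Rightarrow> real) \<Rightarrow>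
   (real \<Rightarrow> real \<Rightarrow> real) \<Rightarrow> (real \<Rightarrow> real \<Rightarrow> real) \<Rightarrow> bool"
where
  "weak_solution L M k p0 q0 p q \<longleftrightarrow>
     (\<forall>t\<ge>0. L2 L (p t) \<and> L2 L (q t)) \<and>
     (\<forall>t\<ge>0. ((\<lambda>s. L2_norm2 L (\<lambda>x. p s x - p t x) (\<lambda>x. q s x - q t x)) \<longlongrightarrow> 0)
               (at t within {0..})) \<and>
     (AE x in lebesgue_on {0<..<L}. p 0 x = p0 x \<and> q 0 x = q0 x) \<and>
     (\<forall>T>0. \<forall>\<phi> \<phi>t \<phi>x \<psi> \<psi>t \<psi>x.
        C1_rect T L \<phi> \<phi>t \<phi>x \<and> C1_rect T L \<psi> \<psi>t \<psi>x \<and>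
        (\<forall>t\<in>{0..T}. \<phi> t L = \<psi> t L \<and> \<psi> t 0 = k * \<phi> t 0) \<longrightarrow>
        L2_inner L (p T) (\<phi> T) + L2_inner L (q T) (\<psi> T) =
        L2_inner L p0 (\<phi> 0) + L2_inner L q0 (\<psi> 0) +
        integral\<^sup>L (lebesgue_on {0..T}) (\<lambda>t.
          L2_inner L (p t) (\<lambda>x. \<phi>t t x + \<phi>x t x - M * \<psi> t x) +
          L2_inner L (q t) (\<lambda>x. \<psi>t t x - \<psi>x t x - M * \<phi> t x)))"

definition unstable_for ::
  "real \<Rightarrow> real \<Rightarrow> real \<Rightarrow> (real \<Rightarrow> real) \<Rightarrow> (real \<Rightarrow> real) \<Rightarrow> bool"
where
  "unstable_for L M k p0 q0 \<longleftrightarrow>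
     (\<forall>p q. weak_solution L M k p0 q0 p q \<longrightarrow>
        \<not> ((\<lambda>t. L2_norm2 L (p t) (q t)) \<longlongrightarrow> 0) at_top)"

end

theory Submission
  imports Defs
begin

text \<open>
  The argument is by duality. Write the system as \<open>u\<^sub>t = - A\<^sup>* u\<close> for \<open>u = (p, q)\<close>, where
  \<open>A (\<phi>, \<psi>) = (- \<phi>' + M \<psi>, \<psi>' + M \<phi>)\<close> with \<open>\<phi>(L) = \<psi>(L)\<close> and \<open>\<psi>(0) = k \<phi>(0)\<close>. If \<open>\<Phi>\<close>
  solves the dual problem \<open>\<Phi>\<^sub>t = A \<Phi>\<close>, then \<open>\<langle>u(t), \<Phi>(t)\<rangle>\<close> does not depend on \<open>t\<close>. If moreover
  \<open>\<Phi>\<close> stays bounded, then \<open>\<bar>\<langle>u(0), \<Phi>(0)\<rangle>\<bar> \<le> C \<parallel>u(T)\<parallel>\<close> for all \<open>T\<close>, so \<open>u(T)\<close> cannot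
  tend to zero as soon as one such \<open>\<Phi>(0)\<close> is not orthogonal to \<open>u(0)\<close>.

  Boundedness is where the hypotheses on \<open>M L\<close> and \<open>k\<close> enter. With the weights
  \<open>a(x) = 1 - 2 M (L - x)\<close> and \<open>b(x) = 1 + 2 M (L - x)\<close> the operator \<open>A\<close> is dissipative for the
  energy \<open>\<integral> \<phi>\<^sup>2 / a + \<psi>\<^sup>2 / b\<close>: the coupling terms complete a square, since \<open>a + b = 2\<close>; the
  boundary term at \<open>L\<close> vanishes, since \<open>a(L) = b(L)\<close>; the one at \<open>0\<close> has the right sign exactly if
  \<open>k\<^sup>2 \<ge> b(0) / a(0)\<close>, which is the bound on the gain. The condition \<open>M L < 1 / 2\<close> makes
  \<open>a\<close> positive.

  No solution of the dual partial differential equation is constructed. Instead the dual flow is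
  replaced by implicit Euler steps \<open>Y\<^sub>n\<^sub>+\<^sub>1 - h A Y\<^sub>n\<^sub>+\<^sub>1 = Y\<^sub>n\<close>. One step is a two-point boundary
  value problem for a linear ordinary differential equation, solved explicitly in
  \<open>implicit_step_exists\<close>, and dissipativity makes it a contraction
  (\<open>implicit_step_contraction\<close>). Testing the weak formulation with the time-independent \<open>Y\<^sub>n\<close>
  shows that \<open>y\<^sub>n(t) = \<langle>u(t), Y\<^sub>n\<rangle>\<close> satisfies the scalar equations \<open>h y\<^sub>n\<^sub>+\<^sub>1' = y\<^sub>n - y\<^sub>n\<^sub>+\<^sub>1\<close>.
  Thus \<open>y\<^sub>n\<^sub>+\<^sub>1(t + h)\<close> and \<open>y\<^sub>n(t)\<close> differ by a second-order Taylor remainder, which second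
  differences of the \<open>Y\<^sub>n\<close> control (\<open>backward_euler_relay\<close>). For a datum in the domain of \<open>A\<^sup>2\<close>
  these are \<open>O(h\<^sup>2)\<close> uniformly in \<open>n\<close>, again by contraction; summing \<open>T / h\<close> remainders and letting
  \<open>h \<rightarrow> 0\<close> gives the bound above (\<open>weak_solution_observability\<close>). Finally, polynomials with
  double zeros at both ends are such data, and some of them is not orthogonal to a given nonzero
  initial state (\<open>exists_admissible_not_orthogonal\<close>).
\<close>

section \<open>The Hilbert space \<open>L\<^sup>2(0,L)\<^sup>2\<close>\<close>

lemma L2_mult_integrable:
  assumes "L2 L f" "L2 L g"
  shows "integrable (lebesgue_on {0<..<L}) (\<lambda>x. f x * g x)"
proof (rule Bochner_Integration.integrable_bound)
  show "integrable (lebesgue_on {0<..<L}) (\<lambda>x. (f x)\<^sup>2 + (g x)\<^sup>2)"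
    using assms by (auto simp: L2_def)
  show "(\<lambda>x. f x * g x) \<in> borel_measurable (lebesgue_on {0<..<L})"
    using assms by (auto simp: L2_def)
  have "\<bar>a * b\<bar> \<le> a\<^sup>2 + b\<^sup>2" for a b :: real
  proof -
    have "0 \<le> (\<bar>a\<bar> - \<bar>b\<bar>)\<^sup>2" by simp
    then have "2 * (\<bar>a\<bar> * \<bar>b\<bar>) \<le> a\<^sup>2 + b\<^sup>2" by (simp add: power2_diff)
    moreover have "0 \<le> \<bar>a\<bar> * \<bar>b\<bar>" by simp
    ultimately show ?thesis unfolding abs_mult by linarith
  qed
  then show "AE x in lebesgue_on {0<..<L}. norm (f x * g x) \<le> norm ((f x)\<^sup>2 + (g x)\<^sup>2)"
    by simp
qed

lemma L2_linear:
  assumes "L2 L f" "L2 L g"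
  shows "L2 L (\<lambda>x. f x + c * g x)"
proof -
  have "(\<lambda>x. (f x + c * g x)\<^sup>2) = (\<lambda>x. (f x)\<^sup>2 + c\<^sup>2 * (g x)\<^sup>2 + 2 * c * (f x * g x))"
    by (auto simp: power2_eq_square algebra_simps)
  then show ?thesis
    using assms L2_mult_integrable[OF assms] by (auto simp: L2_def)
qed

lemma L2_diff: "L2 L f \<Longrightarrow> L2 L g \<Longrightarrow> L2 L (\<lambda>x. f x - g x)"
  using L2_linear[of L f g "-1"] by simp

lemma integrable_continuous_open_interval:
  fixes f :: "real \<Rightarrow> real"
  assumes "continuous_on {0..L} f"
  shows "integrable (lebesgue_on {0<..<L}) f"
proof -
  have "f absolutely_integrable_on {0..L}"
    using absolutely_integrable_continuous[of 0 L f] assms by simp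
  then have "f absolutely_integrable_on {0<..<L}"
    by (rule set_integrable_subset) auto
  then show ?thesis
    by (simp add: integrable_restrict_space set_integrable_def)
qed

lemma integral_continuous_open_interval:
  fixes f :: "real \<Rightarrow> real"
  assumes "continuous_on {0..L} f"
  shows "integral\<^sup>L (lebesgue_on {0<..<L}) f = integral {0..L} f"
  using lebesgue_integral_eq_integral[OF integrable_continuous_open_interval[OF assms]]
  by (simp add: integral_open_interval_real)

lemma L2_continuous:
  assumes "continuous_on {0..L} f"
  shows "L2 L f"
proof -
  have "integrable (lebesgue_on {0<..<L}) f"
    using assms by (rule integrable_continuous_open_interval)
  moreover have "integrable (lebesgue_on {0<..<L}) (\<lambda>x. (f x)\<^sup>2)"
    using assms by (intro integrable_continuous_open_interval continuous_intros)
  ultimately show ?thesis by (simp add: L2_def)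
qed

lemma L2_norm2_nonneg: "0 \<le> L2_norm2 L f g"
  unfolding L2_norm2_def by (intro real_sqrt_ge_zero Bochner_Integration.integral_nonneg) auto

lemma L2_norm2_sq:
  assumes "L2 L f" "L2 L g"
  shows "(L2_norm2 L f g)\<^sup>2 = L2_inner L f f + L2_inner L g g"
proof -
  have "(L2_norm2 L f g)\<^sup>2 = integral\<^sup>L (lebesgue_on {0<..<L}) (\<lambda>x. (f x)\<^sup>2 + (g x)\<^sup>2)"
    unfolding L2_norm2_def by (intro real_sqrt_pow2 Bochner_Integration.integral_nonneg) auto
  also have "\<dots> = L2_inner L f f + L2_inner L g g"
    using assms unfolding L2_inner_def L2_def
    by (subst Bochner_Integration.integral_add) (auto simp: power2_eq_square)
  finally show ?thesis .
qed

lemma L2_inner_commute: "L2_inner L f g = L2_inner L g f"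
  unfolding L2_inner_def by (simp add: mult.commute)

lemma L2_inner_linear_right:
  assumes "L2 L f" "L2 L g" "L2 L h"
  shows "L2_inner L f (\<lambda>x. g x + c * h x) = L2_inner L f g + c * L2_inner L f h"
proof -
  have "(\<lambda>x. f x * (g x + c * h x)) = (\<lambda>x. f x * g x + c * (f x * h x))"
    by (auto simp: algebra_simps)
  then show ?thesis
    using L2_mult_integrable[OF assms(1,2)] L2_mult_integrable[OF assms(1,3)]
    unfolding L2_inner_def by simp
qed

lemma L2_inner_linear_left:
  assumes "L2 L f" "L2 L g" "L2 L h"
  shows "L2_inner L (\<lambda>x. g x + c * h x) f = L2_inner L g f + c * L2_inner L h f"
  using L2_inner_linear_right[OF assms] by (simp add: L2_inner_commute)

lemma L2_inner_diff_left:
  assumes "L2 L f" "L2 L g" "L2 L h"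
  shows "L2_inner L (\<lambda>x. g x - h x) f = L2_inner L g f - L2_inner L h f"
  using L2_inner_linear_left[OF assms, of "-1"] by simp

lemma L2_norm2_sq_linear:
  assumes "L2 L f" "L2 L g" "L2 L \<phi>" "L2 L \<psi>"
  shows "(L2_norm2 L (\<lambda>x. f x + s * \<phi> x) (\<lambda>x. g x + s * \<psi> x))\<^sup>2 =
    (L2_norm2 L f g)\<^sup>2 + 2 * s * (L2_inner L f \<phi> + L2_inner L g \<psi>) + s\<^sup>2 * (L2_norm2 L \<phi> \<psi>)\<^sup>2"
  unfolding L2_norm2_sq[OF assms(1,2)] L2_norm2_sq[OF assms(3,4)]
    L2_norm2_sq[OF L2_linear[OF assms(1,3)] L2_linear[OF assms(2,4)]]
  using assms
  by (simp add: L2_linear L2_inner_linear_left L2_inner_linear_right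
      L2_inner_commute[of L \<phi> f] L2_inner_commute[of L \<psi> g] power2_eq_square algebra_simps)

text \<open>The nonnegative quadratic \<open>s \<mapsto> \<parallel>u + s \<Phi>\<parallel>\<^sup>2\<close> has nonpositive discriminant.\<close>
lemma L2_Cauchy_Schwarz:
  assumes "L2 L f" "L2 L g" "L2 L \<phi>" "L2 L \<psi>"
  shows "\<bar>L2_inner L f \<phi> + L2_inner L g \<psi>\<bar> \<le> L2_norm2 L f g * L2_norm2 L \<phi> \<psi>"
proof -
  define a b c where "a = (L2_norm2 L f g)\<^sup>2" and "b = L2_inner L f \<phi> + L2_inner L g \<psi>"
    and "c = (L2_norm2 L \<phi> \<psi>)\<^sup>2"
  have quad: "0 \<le> a + 2 * s * b + s\<^sup>2 * c" for s
    unfolding a_def b_def c_def using L2_norm2_sq_linear[OF assms, of s] by (metis zero_le_power2)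
  have "c \<ge> 0" by (simp add: c_def)
  have "b\<^sup>2 \<le> a * c"
  proof (cases "c = 0")
    case True
    have "b = 0"
    proof (rule ccontr)
      assume "b \<noteq> 0"
      then show False using quad[of "- (a + 1) / (2 * b)"] True by (simp add: field_simps)
    qed
    then show ?thesis using True by simp
  next
    case False
    then show ?thesis using \<open>c \<ge> 0\<close> quad[of "- b / c"] by (simp add: field_simps power2_eq_square)
  qed
  then have "\<bar>b\<bar>\<^sup>2 \<le> (L2_norm2 L f g * L2_norm2 L \<phi> \<psi>)\<^sup>2"
    by (simp add: a_def c_def power_mult_distrib)
  then show ?thesis
    unfolding b_def by (rule power2_le_imp_le) (simp add: L2_norm2_nonneg)
qed

lemma L2_norm2_triangle:
  assumes "L2 L f" "L2 L g" "L2 L \<phi>" "L2 L \<psi>"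
  shows "L2_norm2 L f g \<le> L2_norm2 L \<phi> \<psi> + L2_norm2 L (\<lambda>x. f x - \<phi> x) (\<lambda>x. g x - \<psi> x)"
proof (rule power2_le_imp_le)
  let ?d = "\<lambda>x. f x - \<phi> x" and ?e = "\<lambda>x. g x - \<psi> x"
  have d: "L2 L ?d" "L2 L ?e" using assms by (auto intro: L2_diff)
  have "(L2_norm2 L f g)\<^sup>2 = (L2_norm2 L \<phi> \<psi>)\<^sup>2
      + 2 * (L2_inner L \<phi> ?d + L2_inner L \<psi> ?e) + (L2_norm2 L ?d ?e)\<^sup>2"
    using L2_norm2_sq_linear[OF assms(3,4) d, of 1] by simp
  also have "\<dots> \<le> (L2_norm2 L \<phi> \<psi> + L2_norm2 L ?d ?e)\<^sup>2"
    using L2_Cauchy_Schwarz[OF assms(3,4) d] by (simp add: power2_sum)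
  finally show "(L2_norm2 L f g)\<^sup>2 \<le> (L2_norm2 L \<phi> \<psi> + L2_norm2 L ?d ?e)\<^sup>2" .
qed (simp add: L2_norm2_nonneg)

lemma L2_norm2_diff_commute:
  "L2_norm2 L (\<lambda>x. f x - \<phi> x) (\<lambda>x. g x - \<psi> x) = L2_norm2 L (\<lambda>x. \<phi> x - f x) (\<lambda>x. \<psi> x - g x)"
  unfolding L2_norm2_def by (simp add: power2_commute)

definition pairing ::
  "real \<Rightarrow> (real \<Rightarrow> real) \<Rightarrow> (real \<Rightarrow> real) \<Rightarrow> (real \<Rightarrow> real) \<Rightarrow> (real \<Rightarrow> real) \<Rightarrow> real" where
  "pairing L f g \<phi> \<psi> = L2_inner L f \<phi> + L2_inner L g \<psi>"

lemma pairing_linear_right: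
  assumes "L2 L f" "L2 L g" "L2 L \<phi>" "L2 L \<psi>" "L2 L \<phi>2" "L2 L \<psi>2"
  shows "pairing L f g (\<lambda>x. \<phi> x + c * \<phi>2 x) (\<lambda>x. \<psi> x + c * \<psi>2 x)
    = pairing L f g \<phi> \<psi> + c * pairing L f g \<phi>2 \<psi>2"
  using assms by (simp add: pairing_def L2_inner_linear_right algebra_simps)

lemma L2_inner_cong:
  assumes "AE x in lebesgue_on {0<..<L}. f x = f2 x" "L2 L f" "L2 L f2" "L2 L g"
  shows "L2_inner L f g = L2_inner L f2 g"
  unfolding L2_inner_def
proof (rule integral_cong_AE)
  show "AE x in lebesgue_on {0<..<L}. f x * g x = f2 x * g x"
    using assms(1) by eventually_elim simp
qed (use assms in \<open>auto simp: L2_def\<close>)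

lemma L2_inner_cong_right:
  assumes "\<And>x. x \<in> {0<..<L} \<Longrightarrow> g x = g2 x"
  shows "L2_inner L f g = L2_inner L f g2"
  unfolding L2_inner_def by (rule Bochner_Integration.integral_cong) (auto simp: assms)

text \<open>The truncation \<open>clip \<circ> f\<close> of \<open>f\<close> to values in \<open>[-1,1]\<close> satisfies \<open>\<integral> f \<cdot> (clip \<circ> f) > 0\<close>.
  A measurable \<open>f\<close> is a limit almost everywhere of continuous \<open>g\<^sub>n\<close>, so by dominated convergence
  some continuous \<open>clip \<circ> g\<^sub>n\<close> has a nonzero integral against \<open>f\<close> as well, and by
  Weierstrass a polynomial close to it does, too.\<close>
lemma exists_polynomial_not_orthogonal:
  fixes f :: "real \<Rightarrow> real"
  assumes f: "integrable (lebesgue_on {0<..<L}) f"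
    and nz: "\<not> (AE x in lebesgue_on {0<..<L}. f x = 0)"
  obtains P where "real_polynomial_function P"
    and "integral\<^sup>L (lebesgue_on {0<..<L}) (\<lambda>x. f x * P x) \<noteq> 0"
proof -
  let ?M = "lebesgue_on {0<..<L}"
  define clip where "clip y = max (-1) (min 1 y)" for y :: real
  have clip_cont: "continuous_on UNIV clip" unfolding clip_def by (intro continuous_intros)
  have clip_bd: "\<bar>clip y\<bar> \<le> 1" for y by (auto simp: clip_def)
  have fm: "f \<in> borel_measurable ?M" using f by auto
  then have "f measurable_on {0<..<L}"
    using measurable_on_iff_borel_measurable[of "{0<..<L}" f] by auto
  then obtain N and g :: "nat \<Rightarrow> real \<Rightarrow> real" where N: "negligible N"
    and gc: "\<And>n. continuous_on UNIV (g n)"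
    and gl: "\<And>x. x \<notin> N \<Longrightarrow> (\<lambda>n. g n x) \<longlonglongrightarrow> (if x \<in> {0<..<L} then f x else 0)"
    unfolding measurable_on_def by blast
  define G where "G n = (\<lambda>x. clip (g n x))" for n
  have Gc: "continuous_on S (G n)" for n S
    unfolding G_def
    using continuous_on_compose2[OF clip_cont gc[of n]] continuous_on_subset by blast
  have Gm: "G n \<in> borel_measurable ?M" for n
    by (rule continuous_imp_measurable_on_sets_lebesgue) (auto simp: Gc)
  have AE_N: "AE x in ?M. x \<notin> N"
  proof -
    have "N \<in> null_sets lebesgue" using N by (simp add: negligible_iff_null_sets)
    then have "AE x in lebesgue. x \<notin> N" by (rule AE_not_in)
    then show ?thesis by (subst AE_restrict_space_iff) (auto elim: eventually_mono)
  qed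
  have cm: "(\<lambda>x. clip (f x)) \<in> borel_measurable ?M"
    using fm unfolding clip_def by measurable
  have lim: "(\<lambda>n. integral\<^sup>L ?M (\<lambda>x. f x * G n x)) \<longlonglongrightarrow> integral\<^sup>L ?M (\<lambda>x. f x * clip (f x))"
  proof (rule integral_dominated_convergence[where w = "\<lambda>x. \<bar>f x\<bar>"])
    show "AE x in ?M. (\<lambda>n. f x * G n x) \<longlonglongrightarrow> f x * clip (f x)"
      using AE_N AE_space
    proof eventually_elim
      case (elim x)
      then have "(\<lambda>n. g n x) \<longlonglongrightarrow> f x" using gl[of x] by auto
      moreover have "isCont clip (f x)"
        using clip_cont by (simp add: continuous_on_eq_continuous_at)
      ultimately have "(\<lambda>n. G n x) \<longlonglongrightarrow> clip (f x)"
        unfolding G_def by (rule isCont_tendsto_compose[rotated])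
      then show ?case by (intro tendsto_intros)
    qed
    show "AE x in ?M. norm (f x * G n x) \<le> \<bar>f x\<bar>" for n
      using clip_bd by (auto simp: G_def abs_mult intro!: mult_left_le AE_I2)
  qed (use f fm Gm cm in auto)
  have intc: "integrable ?M (\<lambda>x. f x * clip (f x))"
  proof (rule Bochner_Integration.integrable_bound[OF f])
    show "AE x in ?M. norm (f x * clip (f x)) \<le> norm (f x)"
      using clip_bd by (auto simp: abs_mult intro!: mult_left_le AE_I2)
  qed (use fm cm in auto)
  have sgn: "0 \<le> y * clip y" "y * clip y = 0 \<longleftrightarrow> y = 0" for y
    by (auto simp: clip_def max_def min_def zero_le_mult_iff)
  have "integral\<^sup>L ?M (\<lambda>x. f x * clip (f x)) \<noteq> 0"
    using integral_nonneg_eq_0_iff_AE[OF intc] sgn nz by simp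
  then have "eventually (\<lambda>n. integral\<^sup>L ?M (\<lambda>x. f x * G n x) \<noteq> 0) sequentially"
    by (rule tendsto_imp_eventually_ne[OF lim])
  then obtain n where n: "integral\<^sup>L ?M (\<lambda>x. f x * G n x) \<noteq> 0"
    by (auto simp: eventually_sequentially)
  define I where "I = integral\<^sup>L ?M (\<lambda>x. \<bar>f x\<bar>)"
  \<comment> \<open>A uniform error below \<open>e\<close> changes the integral by less than its absolute value; the summand
     \<open>1\<close> only keeps the denominator positive.\<close>
  define e where "e = \<bar>integral\<^sup>L ?M (\<lambda>x. f x * G n x)\<bar> / (I + 1)"
  have I0: "I \<ge> 0" unfolding I_def by (rule Bochner_Integration.integral_nonneg) auto
  then have "e > 0" using n by (simp add: e_def)
  then obtain P where P: "real_polynomial_function P"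
    and PG: "\<And>x. x \<in> {0..L} \<Longrightarrow> \<bar>G n x - P x\<bar> < e"
    using Stone_Weierstrass_real_polynomial_function[of "{0..L}" "G n" e] Gc by auto
  have Pc: "continuous_on S P" for S
    using P by (simp add: continuous_on_polymonial_function real_polynomial_function_eq)
  have Pm: "P \<in> borel_measurable ?M"
    by (rule continuous_imp_measurable_on_sets_lebesgue) (auto simp: Pc)
  have bnd: "AE x in ?M. \<bar>f x * (G n x - P x)\<bar> \<le> e * \<bar>f x\<bar>"
  proof (rule AE_I2)
    fix x assume "x \<in> space ?M"
    then have "\<bar>G n x - P x\<bar> \<le> e" using PG[of x] by auto
    then show "\<bar>f x * (G n x - P x)\<bar> \<le> e * \<bar>f x\<bar>"
      unfolding abs_mult by (subst mult.commute) (rule mult_right_mono, auto)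
  qed
  have iG: "integrable ?M (\<lambda>x. f x * G n x)"
  proof (rule Bochner_Integration.integrable_bound[OF f])
    show "AE x in ?M. norm (f x * G n x) \<le> norm (f x)"
      using clip_bd by (auto simp: G_def abs_mult intro!: mult_left_le AE_I2)
  qed (use fm Gm in auto)
  have iD: "integrable ?M (\<lambda>x. f x * (G n x - P x))"
  proof (rule Bochner_Integration.integrable_bound)
    show "integrable ?M (\<lambda>x. e * \<bar>f x\<bar>)" using f by auto
    show "AE x in ?M. norm (f x * (G n x - P x)) \<le> norm (e * \<bar>f x\<bar>)"
      using bnd \<open>e > 0\<close> by (simp add: abs_mult)
  qed (use fm Gm Pm in auto)
  have "\<bar>integral\<^sup>L ?M (\<lambda>x. f x * (G n x - P x))\<bar> \<le> integral\<^sup>L ?M (\<lambda>x. \<bar>f x * (G n x - P x)\<bar>)"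
    by (rule integral_abs_bound)
  also have "\<dots> \<le> integral\<^sup>L ?M (\<lambda>x. e * \<bar>f x\<bar>)"
    using iD f bnd by (intro integral_mono_AE) auto
  also have "\<dots> = e * I" by (simp add: I_def)
  also have "\<dots> < \<bar>integral\<^sup>L ?M (\<lambda>x. f x * G n x)\<bar>"
    using I0 n by (simp add: e_def field_simps)
  finally have lt: "\<bar>integral\<^sup>L ?M (\<lambda>x. f x * (G n x - P x))\<bar> < \<bar>integral\<^sup>L ?M (\<lambda>x. f x * G n x)\<bar>" .
  have "integral\<^sup>L ?M (\<lambda>x. f x * P x)
      = integral\<^sup>L ?M (\<lambda>x. f x * G n x) - integral\<^sup>L ?M (\<lambda>x. f x * (G n x - P x))"
    using iG iD by (subst Bochner_Integration.integral_diff[symmetric]) (auto simp: algebra_simps)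
  then have "integral\<^sup>L ?M (\<lambda>x. f x * P x) \<noteq> 0" using lt by auto
  then show ?thesis using that P by blast
qed

section \<open>Weak solutions as continuous curves in \<open>L\<^sup>2\<close>\<close>

lemma C1_rect_constant_in_time:
  assumes "\<And>x. x \<in> {0..L} \<Longrightarrow> (\<phi> has_real_derivative \<phi>' x) (at x within {0..L})"
    and "continuous_on {0..L} \<phi>'"
  shows "C1_rect T L (\<lambda>t. \<phi>) (\<lambda>t x. 0) (\<lambda>t. \<phi>')"
  unfolding C1_rect_def
proof (intro conjI ballI)
  fix t x assume t: "t \<in> {0..T}" and x: "x \<in> {0..L}"
  have "(\<phi> has_derivative (*) (\<phi>' x)) (at x within {0..L})"
    using assms(1)[OF x] by (simp add: has_field_derivative_def)
  then have "(\<phi> has_derivative (*) (\<phi>' x)) (at x within snd ` ({0..T} \<times> {0..L}))"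
    by (rule has_derivative_subset) auto
  then have "((\<lambda>z. \<phi> (snd z)) has_derivative (\<lambda>h. \<phi>' x * snd h)) (at (t, x) within {0..T} \<times> {0..L})"
    using has_derivative_in_compose[of snd snd "(t, x)" "{0..T} \<times> {0..L}" \<phi> "(*) (\<phi>' x)"]
    by (simp add: has_derivative_snd[OF has_derivative_ident])
  then show "((\<lambda>z. \<phi> (snd z)) has_derivative (\<lambda>h. 0 * fst h + \<phi>' x * snd h))
      (at (t, x) within {0..T} \<times> {0..L})"
    by simp
next
  show "continuous_on ({0..T} \<times> {0..L}) (\<lambda>z. \<phi>' (snd z))"
    by (intro continuous_on_compose2[OF assms(2) continuous_on_snd[OF continuous_on_id]]) auto
qed simp

lemma weak_solution_L2:
  assumes "weak_solution L M k p0 q0 p q" "t \<ge> 0"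
  shows "L2 L (p t)" "L2 L (q t)"
  using assms unfolding weak_solution_def by auto

lemma weak_solution_continuous:
  assumes "weak_solution L M k p0 q0 p q" "t \<ge> 0"
  shows "((\<lambda>s. L2_norm2 L (\<lambda>x. p s x - p t x) (\<lambda>x. q s x - q t x)) \<longlongrightarrow> 0) (at t within {0..})"
  using assms unfolding weak_solution_def by auto

text \<open>The purpose is a bound for the solution that is uniform on compact time intervals.\<close>
lemma weak_solution_norm_continuous:
  assumes ws: "weak_solution L M k p0 q0 p q"
  shows "continuous_on {0..} (\<lambda>t. L2_norm2 L (p t) (q t))"
  unfolding continuous_on_def
proof
  fix t :: real assume t: "t \<in> {0..}"
  let ?N = "\<lambda>t. L2_norm2 L (p t) (q t)"
  let ?d = "\<lambda>s. L2_norm2 L (\<lambda>x. p s x - p t x) (\<lambda>x. q s x - q t x)"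
  have "((\<lambda>s. ?N s - ?N t) \<longlongrightarrow> 0) (at t within {0..})"
  proof (rule tendsto_0_le)
    show "(?d \<longlongrightarrow> 0) (at t within {0..})"
      using weak_solution_continuous[OF ws] t by auto
    have "\<bar>?N s - ?N t\<bar> \<le> ?d s" if "s \<ge> 0" for s
    proof -
      note l = weak_solution_L2[OF ws, of s] weak_solution_L2[OF ws, of t]
      have "?N s \<le> ?N t + ?d s" using l that t by (intro L2_norm2_triangle) auto
      moreover have "?N t \<le> ?N s + ?d s"
        using L2_norm2_triangle[of L "p t" "q t" "p s" "q s"] l that t
          L2_norm2_diff_commute[of L "p t" "p s" "q t" "q s"] by simp
      ultimately show ?thesis by linarith
    qed
    then show "eventually (\<lambda>s. norm (?N s - ?N t) \<le> norm (?d s) * 1) (at t within {0..})"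
      by (auto simp: eventually_at_filter L2_norm2_nonneg intro!: always_eventually)
  qed
  then show "(?N \<longlongrightarrow> ?N t) (at t within {0..})"
    by (simp add: LIM_zero_iff)
qed

lemma weak_solution_pairing_continuous:
  assumes ws: "weak_solution L M k p0 q0 p q" and L2: "L2 L \<phi>" "L2 L \<psi>"
  shows "continuous_on {0..} (\<lambda>t. pairing L (p t) (q t) \<phi> \<psi>)"
  unfolding continuous_on_def
proof
  fix t :: real assume t: "t \<in> {0..}"
  let ?y = "\<lambda>t. pairing L (p t) (q t) \<phi> \<psi>"
  let ?d = "\<lambda>s. L2_norm2 L (\<lambda>x. p s x - p t x) (\<lambda>x. q s x - q t x)"
  have "((\<lambda>s. ?y s - ?y t) \<longlongrightarrow> 0) (at t within {0..})"
  proof (rule tendsto_0_le)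
    show "(?d \<longlongrightarrow> 0) (at t within {0..})"
      using weak_solution_continuous[OF ws] t by auto
    have "\<bar>?y s - ?y t\<bar> \<le> ?d s * L2_norm2 L \<phi> \<psi>" if "s \<ge> 0" for s
    proof -
      have l: "L2 L (p s)" "L2 L (q s)" "L2 L (p t)" "L2 L (q t)"
        using weak_solution_L2[OF ws, of s] weak_solution_L2[OF ws, of t] t that by auto
      have "?y s - ?y t = pairing L (\<lambda>x. p s x - p t x) (\<lambda>x. q s x - q t x) \<phi> \<psi>"
        using l L2 by (simp add: pairing_def L2_inner_diff_left)
      then show ?thesis
        using L2_Cauchy_Schwarz[OF L2_diff[OF l(1,3)] L2_diff[OF l(2,4)] L2] by (simp add: pairing_def)
    qed
    then show "eventually (\<lambda>s. norm (?y s - ?y t) \<le> norm (?d s) * L2_norm2 L \<phi> \<psi>) (at t within {0..})"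
      by (auto simp: eventually_at_filter L2_norm2_nonneg intro!: always_eventually)
  qed
  then show "(?y \<longlongrightarrow> ?y t) (at t within {0..})"
    by (simp add: LIM_zero_iff)
qed

section \<open>The dual generator and its dissipativity\<close>

text \<open>The parameters of the closed loop, with the hypotheses under which the dual flow is
  bounded.\<close>
locale dual_feedback_system =
  fixes L M k :: real
  assumes L_pos: "L > 0" and M_pos: "M > 0" and coupling_small: "M * L < 1 / 2"
    and gain: "k\<^sup>2 \<ge> (1 + 2 * M * L) / (1 - 2 * M * L)"
begin

text \<open>One implicit Euler step \<open>(\<phi>, \<psi>) - h A (\<phi>, \<psi>) = (f, g)\<close> for the dual generator. It is a
  relation because the values outside \<open>[0,L]\<close> are arbitrary; the boundary conditions are those that
  the test functions of the weak formulation must satisfy.\<close>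
definition implicit_step ::
  "real \<Rightarrow> (real \<Rightarrow> real) \<Rightarrow> (real \<Rightarrow> real) \<Rightarrow> (real \<Rightarrow> real) \<Rightarrow> (real \<Rightarrow> real) \<Rightarrow> bool" where
  "implicit_step h f g \<phi> \<psi> \<longleftrightarrow> (\<exists>\<phi>' \<psi>'.
     (\<forall>x\<in>{0..L}. (\<phi> has_real_derivative \<phi>' x) (at x within {0..L}) \<and>
                 (\<psi> has_real_derivative \<psi>' x) (at x within {0..L}) \<and>
                 \<phi> x - h * (- \<phi>' x + M * \<psi> x) = f x \<and>
                 \<psi> x - h * (\<psi>' x + M * \<phi> x) = g x) \<and>
     continuous_on {0..L} \<phi>' \<and> continuous_on {0..L} \<psi>' \<and> \<phi> L = \<psi> L \<and> \<psi> 0 = k * \<phi> 0)"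

text \<open>The reciprocals of these weights make the dual generator dissipative. They sum to \<open>2\<close>,
  agree at \<open>L\<close>, and their slopes \<open>\<plusminus> 2 M\<close> are what the coupling of size \<open>M\<close> requires.\<close>
definition weight_plus :: "real \<Rightarrow> real" where "weight_plus x = 1 - 2 * M * (L - x)"
definition weight_minus :: "real \<Rightarrow> real" where "weight_minus x = 1 + 2 * M * (L - x)"

definition dual_energy :: "(real \<Rightarrow> real) \<Rightarrow> (real \<Rightarrow> real) \<Rightarrow> real" where
  "dual_energy f g = integral {0..L} (\<lambda>x. (f x)\<^sup>2 / weight_plus x + (g x)\<^sup>2 / weight_minus x)"

lemma weight_bounds:
  assumes "x \<in> {0..L}"
  shows "0 < weight_plus x" "weight_plus x \<le> 1" "0 < weight_minus x" "weight_minus x \<le> 2"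
proof -
  have "0 \<le> M * (L - x)" "M * (L - x) \<le> M * L"
    using assms M_pos by (auto intro: mult_left_mono)
  then show "0 < weight_plus x" "weight_plus x \<le> 1" "0 < weight_minus x" "weight_minus x \<le> 2"
    using coupling_small by (auto simp: weight_plus_def weight_minus_def)
qed

lemma dual_energy_integrand_continuous:
  assumes "continuous_on {0..L} f" "continuous_on {0..L} g"
  shows "continuous_on {0..L} (\<lambda>x. (f x)\<^sup>2 / weight_plus x + (g x)\<^sup>2 / weight_minus x)"
proof (intro continuous_intros assms ballI)
  show "continuous_on {0..L} weight_plus" unfolding weight_plus_def by (intro continuous_intros)
  show "continuous_on {0..L} weight_minus" unfolding weight_minus_def by (intro continuous_intros)
qed (use weight_bounds in fastforce)+

lemma dual_energy_nonneg: "0 \<le> dual_energy f g"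
proof (cases "(\<lambda>x. (f x)\<^sup>2 / weight_plus x + (g x)\<^sup>2 / weight_minus x) integrable_on {0..L}")
  case True
  show ?thesis unfolding dual_energy_def
  proof (rule integral_nonneg[OF True])
    fix x assume "x \<in> {0..L}"
    then show "0 \<le> (f x)\<^sup>2 / weight_plus x + (g x)\<^sup>2 / weight_minus x"
      using weight_bounds[of x] by simp
  qed
qed (simp add: dual_energy_def not_integrable_integral)

lemma dual_energy_scale: "dual_energy (\<lambda>x. c * f x) (\<lambda>x. c * g x) = c\<^sup>2 * dual_energy f g"
proof -
  have "(\<lambda>x. (c * f x)\<^sup>2 / weight_plus x + (c * g x)\<^sup>2 / weight_minus x)
      = (\<lambda>x. c\<^sup>2 * ((f x)\<^sup>2 / weight_plus x + (g x)\<^sup>2 / weight_minus x))"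
    by (auto simp: power_mult_distrib algebra_simps)
  then show ?thesis unfolding dual_energy_def by simp
qed

lemma L2_norm2_le_dual_energy:
  assumes "continuous_on {0..L} f" "continuous_on {0..L} g"
  shows "L2_norm2 L f g \<le> sqrt (2 * dual_energy f g)"
proof -
  have "integral\<^sup>L (lebesgue_on {0<..<L}) (\<lambda>x. (f x)\<^sup>2 + (g x)\<^sup>2) = integral {0..L} (\<lambda>x. (f x)\<^sup>2 + (g x)\<^sup>2)"
    by (intro integral_continuous_open_interval continuous_intros assms)
  also have "\<dots> \<le> integral {0..L} (\<lambda>x. 2 * ((f x)\<^sup>2 / weight_plus x + (g x)\<^sup>2 / weight_minus x))"
  proof (rule integral_le)
    fix x assume "x \<in> {0..L}"
    note w = weight_bounds[OF this]
    have "(f x)\<^sup>2 * weight_plus x \<le> (f x)\<^sup>2 * 2" "(g x)\<^sup>2 * weight_minus x \<le> (g x)\<^sup>2 * 2"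
      using w by (auto intro!: mult_left_mono)
    then have "(f x)\<^sup>2 \<le> 2 * ((f x)\<^sup>2 / weight_plus x)" "(g x)\<^sup>2 \<le> 2 * ((g x)\<^sup>2 / weight_minus x)"
      using w by (simp_all add: field_simps)
    then show "(f x)\<^sup>2 + (g x)\<^sup>2 \<le> 2 * ((f x)\<^sup>2 / weight_plus x + (g x)\<^sup>2 / weight_minus x)"
      by simp
  qed (intro integrable_continuous_real continuous_intros assms dual_energy_integrand_continuous)+
  also have "\<dots> = 2 * dual_energy f g" unfolding dual_energy_def by (rule integral_mult_right)
  finally show ?thesis unfolding L2_norm2_def by simp
qed

lemma implicit_step_continuous:
  assumes "implicit_step h f g \<phi> \<psi>"
  shows "continuous_on {0..L} f" "continuous_on {0..L} g"
    "continuous_on {0..L} \<phi>" "continuous_on {0..L} \<psi>"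
proof -
  obtain \<phi>' \<psi>' where d: "\<And>x. x \<in> {0..L} \<Longrightarrow> (\<phi> has_real_derivative \<phi>' x) (at x within {0..L})"
      "\<And>x. x \<in> {0..L} \<Longrightarrow> (\<psi> has_real_derivative \<psi>' x) (at x within {0..L})"
    and e: "\<And>x. x \<in> {0..L} \<Longrightarrow> \<phi> x - h * (- \<phi>' x + M * \<psi> x) = f x"
      "\<And>x. x \<in> {0..L} \<Longrightarrow> \<psi> x - h * (\<psi>' x + M * \<phi> x) = g x"
    and c: "continuous_on {0..L} \<phi>'" "continuous_on {0..L} \<psi>'"
    using assms unfolding implicit_step_def by blast
  show phi: "continuous_on {0..L} \<phi>" "continuous_on {0..L} \<psi>"
    by (rule DERIV_continuous_on[OF d(1)], assumption, rule DERIV_continuous_on[OF d(2)], assumption)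
  show "continuous_on {0..L} f"
    by (rule continuous_on_eq[OF _ e(1)]) (intro continuous_intros phi c)
  show "continuous_on {0..L} g"
    by (rule continuous_on_eq[OF _ e(2)]) (intro continuous_intros phi c)
qed

lemma implicit_step_linear:
  assumes "implicit_step h f g \<phi> \<psi>" "implicit_step h f2 g2 \<phi>2 \<psi>2"
  shows "implicit_step h (\<lambda>x. f x + c * f2 x) (\<lambda>x. g x + c * g2 x)
    (\<lambda>x. \<phi> x + c * \<phi>2 x) (\<lambda>x. \<psi> x + c * \<psi>2 x)"
proof -
  obtain \<phi>' \<psi>' where d: "\<And>x. x \<in> {0..L} \<Longrightarrow> (\<phi> has_real_derivative \<phi>' x) (at x within {0..L})"
      "\<And>x. x \<in> {0..L} \<Longrightarrow> (\<psi> has_real_derivative \<psi>' x) (at x within {0..L})"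
    and e: "\<And>x. x \<in> {0..L} \<Longrightarrow> \<phi> x - h * (- \<phi>' x + M * \<psi> x) = f x"
      "\<And>x. x \<in> {0..L} \<Longrightarrow> \<psi> x - h * (\<psi>' x + M * \<phi> x) = g x"
    and c: "continuous_on {0..L} \<phi>'" "continuous_on {0..L} \<psi>'" "\<phi> L = \<psi> L" "\<psi> 0 = k * \<phi> 0"
    using assms(1) unfolding implicit_step_def by blast
  obtain \<phi>2' \<psi>2' where d2: "\<And>x. x \<in> {0..L} \<Longrightarrow> (\<phi>2 has_real_derivative \<phi>2' x) (at x within {0..L})"
      "\<And>x. x \<in> {0..L} \<Longrightarrow> (\<psi>2 has_real_derivative \<psi>2' x) (at x within {0..L})"
    and e2: "\<And>x. x \<in> {0..L} \<Longrightarrow> \<phi>2 x - h * (- \<phi>2' x + M * \<psi>2 x) = f2 x"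
      "\<And>x. x \<in> {0..L} \<Longrightarrow> \<psi>2 x - h * (\<psi>2' x + M * \<phi>2 x) = g2 x"
    and c2: "continuous_on {0..L} \<phi>2'" "continuous_on {0..L} \<psi>2'" "\<phi>2 L = \<psi>2 L" "\<psi>2 0 = k * \<phi>2 0"
    using assms(2) unfolding implicit_step_def by blast
  show ?thesis
    unfolding implicit_step_def
  proof (intro exI conjI ballI)
    fix x assume x: "x \<in> {0..L}"
    show "((\<lambda>x. \<phi> x + c * \<phi>2 x) has_real_derivative \<phi>' x + c * \<phi>2' x) (at x within {0..L})"
      by (intro DERIV_add DERIV_cmult d d2 x)
    show "((\<lambda>x. \<psi> x + c * \<psi>2 x) has_real_derivative \<psi>' x + c * \<psi>2' x) (at x within {0..L})"
      by (intro DERIV_add DERIV_cmult d d2 x)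
    show "(\<phi> x + c * \<phi>2 x) - h * (- (\<phi>' x + c * \<phi>2' x) + M * (\<psi> x + c * \<psi>2 x)) = f x + c * f2 x"
      using x by (simp add: e[symmetric] e2[symmetric] algebra_simps)
    show "(\<psi> x + c * \<psi>2 x) - h * (\<psi>' x + c * \<psi>2' x + M * (\<phi> x + c * \<phi>2 x)) = g x + c * g2 x"
      using x by (simp add: e[symmetric] e2[symmetric] algebra_simps)
  qed (use c c2 in \<open>auto intro!: continuous_intros simp: algebra_simps\<close>)
qed

lemma DERIV_weighted_square:
  fixes u w :: "real \<Rightarrow> real"
  assumes "(u has_real_derivative u') (at x within X)" "(w has_real_derivative w') (at x within X)"
    and "w x \<noteq> 0"
  shows "((\<lambda>x. (u x)\<^sup>2 / (2 * w x)) has_real_derivative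
    u x * u' / w x - w' / 2 * (u x)\<^sup>2 / (w x)\<^sup>2) (at x within X)"
proof -
  have "((\<lambda>x. (u x)\<^sup>2 / (2 * w x)) has_real_derivative
      (2 * u x * u' * (2 * w x) - (u x)\<^sup>2 * (2 * w')) / ((2 * w x) * (2 * w x))) (at x within X)"
    using assms by (auto intro!: derivative_eq_intros)
  moreover have "(2 * u x * u' * (2 * w x) - (u x)\<^sup>2 * (2 * w')) / ((2 * w x) * (2 * w x))
      = u x * u' / w x - w' / 2 * (u x)\<^sup>2 / (w x)\<^sup>2"
    using assms(3) by (simp add: field_simps power2_eq_square)
  ultimately show ?thesis by simp
qed

text \<open>Pointwise, the energy decreases in an implicit step up to a total derivative: the bracket
  on the right is the derivative of \<open>v\<^sup>2 / (2 b) - u\<^sup>2 / (2 a)\<close> along \<open>a' = 2 M\<close> and \<open>b' = - 2 M\<close>.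
  What is discarded is \<open>h\<^sup>2\<close> times the energy of \<open>A (u, v)\<close> and the square
  \<open>2 h M (u / a - v / b)\<^sup>2\<close>, which absorbs the coupling because \<open>1 / a + 1 / b = 2 / (a b)\<close>.\<close>
lemma dissipation_inequality:
  fixes a b u v u' v' h :: real
  assumes "a > 0" "b > 0" "a + b = 2" "h > 0"
  shows "u\<^sup>2 / a + v\<^sup>2 / b - ((u - h * (- u' + M * v))\<^sup>2 / a + (v - h * (v' + M * u))\<^sup>2 / b)
    \<le> 2 * h * (v * v' / b + M * v\<^sup>2 / b\<^sup>2 - u * u' / a + M * u\<^sup>2 / a\<^sup>2)"
proof -
  define \<alpha> \<beta> U V where "\<alpha> = - u' + M * v" and "\<beta> = v' + M * u" and "U = u / a" and "V = v / b"
  have uv: "u = a * U" "v = b * V" using assms by (simp_all add: U_def V_def)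
  have square: "x\<^sup>2 / c - (x - h * y)\<^sup>2 / c \<le> 2 * h * (x / c * y)" if "c > 0" for x y c :: real
  proof -
    have "x\<^sup>2 - (x - h * y)\<^sup>2 \<le> 2 * h * x * y"
      by (simp add: power2_diff)
    then have "(x\<^sup>2 - (x - h * y)\<^sup>2) / c \<le> 2 * h * x * y / c"
      using that by (intro divide_right_mono) auto
    then show ?thesis by (simp add: diff_divide_distrib mult.assoc)
  qed
  have "u\<^sup>2 / a + v\<^sup>2 / b - ((u - h * \<alpha>)\<^sup>2 / a + (v - h * \<beta>)\<^sup>2 / b)
      \<le> 2 * h * (U * \<alpha>) + 2 * h * (V * \<beta>)"
    using square[OF assms(1), of u \<alpha>] square[OF assms(2), of v \<beta>] unfolding U_def V_def by linarith
  also have "\<dots> = 2 * h * (U * \<alpha> + V * \<beta>)"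
    by (simp add: distrib_left)
  also have "U * \<alpha> + V * \<beta> = V * v' + M * V\<^sup>2 - U * u' + M * U\<^sup>2 - M * (U - V)\<^sup>2"
  proof -
    have "U * \<alpha> + V * \<beta> = V * v' - U * u' + M * (U * V) * (a + b)"
      unfolding \<alpha>_def \<beta>_def uv by (simp add: algebra_simps)
    then show ?thesis unfolding assms(3) by (simp add: power2_eq_square algebra_simps)
  qed
  also have "2 * h * \<dots> \<le> 2 * h * (V * v' + M * V\<^sup>2 - U * u' + M * U\<^sup>2)"
    using assms M_pos by (intro mult_left_mono) auto
  also have "\<dots> = 2 * h * (v * v' / b + M * v\<^sup>2 / b\<^sup>2 - u * u' / a + M * u\<^sup>2 / a\<^sup>2)"
    by (simp add: U_def V_def power_divide)
  finally show ?thesis by (simp add: \<alpha>_def \<beta>_def)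
qed

text \<open>After integration of the pointwise inequality only the boundary values of
  \<open>Q = \<psi>\<^sup>2 / (2 b) - \<phi>\<^sup>2 / (2 a)\<close> remain. At \<open>L\<close> the two terms cancel; at \<open>0\<close>, where \<open>\<psi> = k \<phi>\<close>,
  the lower bound on \<open>k\<^sup>2\<close> gives \<open>Q \<ge> 0\<close>.\<close>
lemma implicit_step_contraction:
  assumes "implicit_step h f g \<phi> \<psi>" "h > 0"
  shows "dual_energy \<phi> \<psi> \<le> dual_energy f g"
proof -
  obtain \<phi>' \<psi>' where d: "\<And>x. x \<in> {0..L} \<Longrightarrow> (\<phi> has_real_derivative \<phi>' x) (at x within {0..L})"
      "\<And>x. x \<in> {0..L} \<Longrightarrow> (\<psi> has_real_derivative \<psi>' x) (at x within {0..L})"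
    and e: "\<And>x. x \<in> {0..L} \<Longrightarrow> \<phi> x - h * (- \<phi>' x + M * \<psi> x) = f x"
      "\<And>x. x \<in> {0..L} \<Longrightarrow> \<psi> x - h * (\<psi>' x + M * \<phi> x) = g x"
    and bc: "\<phi> L = \<psi> L" "\<psi> 0 = k * \<phi> 0"
    using assms(1) unfolding implicit_step_def by blast
  note cont = implicit_step_continuous[OF assms(1)]
  define Q where "Q x = (\<psi> x)\<^sup>2 / (2 * weight_minus x) - (\<phi> x)\<^sup>2 / (2 * weight_plus x)" for x
  define D where "D x = \<psi> x * \<psi>' x / weight_minus x + M * (\<psi> x)\<^sup>2 / (weight_minus x)\<^sup>2
      - \<phi> x * \<phi>' x / weight_plus x + M * (\<phi> x)\<^sup>2 / (weight_plus x)\<^sup>2" for x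
  have "(D has_integral Q L - Q 0) {0..L}"
  proof (rule fundamental_theorem_of_calculus)
    fix x assume x: "x \<in> {0..L}"
    note w = weight_bounds[OF x]
    have "(weight_plus has_real_derivative 2 * M) (at x within {0..L})"
      unfolding weight_plus_def by (auto intro!: derivative_eq_intros)
    moreover have "(weight_minus has_real_derivative - 2 * M) (at x within {0..L})"
      unfolding weight_minus_def by (auto intro!: derivative_eq_intros)
    ultimately have "(Q has_real_derivative D x) (at x within {0..L})"
      unfolding Q_def D_def using w
      using DERIV_diff[OF DERIV_weighted_square[OF d(2)[OF x], of weight_minus "- 2 * M"]
          DERIV_weighted_square[OF d(1)[OF x], of weight_plus "2 * M"]]
      by (simp add: diff_diff_eq2 diff_add_eq)
    then show "(Q has_vector_derivative D x) (at x within {0..L})"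
      by (simp add: has_real_derivative_iff_has_vector_derivative)
  qed (use L_pos in simp)
  then have I1: "((\<lambda>x. 2 * h * D x) has_integral 2 * h * (Q L - Q 0)) {0..L}"
    by (rule has_integral_mult_right)
  have "((\<lambda>x. ((\<phi> x)\<^sup>2 / weight_plus x + (\<psi> x)\<^sup>2 / weight_minus x) - ((f x)\<^sup>2 / weight_plus x + (g x)\<^sup>2 / weight_minus x))
      has_integral dual_energy \<phi> \<psi> - dual_energy f g) {0..L}"
    unfolding dual_energy_def
    by (intro has_integral_diff integrable_integral integrable_continuous_real
        dual_energy_integrand_continuous cont)
  then have "dual_energy \<phi> \<psi> - dual_energy f g \<le> 2 * h * (Q L - Q 0)"
  proof (rule has_integral_le[OF _ I1])
    fix x assume x: "x \<in> {0..L}"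
    have "weight_plus x + weight_minus x = 2" by (simp add: weight_plus_def weight_minus_def)
    from dissipation_inequality[OF weight_bounds(1)[OF x] weight_bounds(3)[OF x] this assms(2),
        of "\<phi> x" "\<psi> x" "\<phi>' x" "\<psi>' x"]
    show "((\<phi> x)\<^sup>2 / weight_plus x + (\<psi> x)\<^sup>2 / weight_minus x) - ((f x)\<^sup>2 / weight_plus x + (g x)\<^sup>2 / weight_minus x)
        \<le> 2 * h * D x"
      unfolding D_def e[OF x] .
  qed
  moreover have "Q L = 0" by (simp add: Q_def bc weight_plus_def weight_minus_def)
  moreover have "0 \<le> Q 0"
  proof -
    have w: "0 < weight_plus 0" "0 < weight_minus 0" using weight_bounds[of 0] L_pos by auto
    have "weight_minus 0 / weight_plus 0 \<le> k\<^sup>2" using gain by (simp add: weight_plus_def weight_minus_def algebra_simps)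
    then have "weight_minus 0 \<le> k\<^sup>2 * weight_plus 0" using w by (simp add: pos_divide_le_eq)
    then have "1 / weight_plus 0 \<le> k\<^sup>2 / weight_minus 0" using w by (simp add: frac_le_eq divide_le_eq pos_le_divide_eq)
    then have "(\<phi> 0)\<^sup>2 / 2 * (1 / weight_plus 0) \<le> (\<phi> 0)\<^sup>2 / 2 * (k\<^sup>2 / weight_minus 0)"
      by (intro mult_left_mono) auto
    then show ?thesis by (simp add: Q_def bc power_mult_distrib mult.commute)
  qed
  ultimately have "2 * h * (Q L - Q 0) \<le> 0"
    using assms(2) by (intro mult_nonneg_nonpos) auto
  then show ?thesis using \<open>dual_energy \<phi> \<psi> - dual_energy f g \<le> 2 * h * (Q L - Q 0)\<close> by simp
qed

text \<open>For the matrix \<open>B = ((-r, M), (-M, r))\<close> one has \<open>B\<^sup>2 = (r\<^sup>2 - M\<^sup>2) I\<close>, hence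
  \<open>exp (x B) = C I + S B\<close> with \<open>C = cosh (\<mu> x)\<close>, \<open>S = sinh (\<mu> x) / \<mu>\<close>, \<open>\<mu>\<^sup>2 = r\<^sup>2 - M\<^sup>2\<close>. Here
  \<open>(u1, u2) = exp (x B) (w1, w2)\<close>, and \<open>(w1, w2)\<close> has derivative \<open>exp (- x B) (F1, F2)\<close>, so that
  \<open>u' = B u + F\<close>.\<close>
lemma exponential_variation_of_constants:
  fixes C S w1 w2 F1 F2 :: "real \<Rightarrow> real" and r :: real
  defines "u1 \<equiv> \<lambda>x. (C x - r * S x) * w1 x + M * S x * w2 x"
    and "u2 \<equiv> \<lambda>x. - M * S x * w1 x + (C x + r * S x) * w2 x"
  assumes dC: "(C has_real_derivative (r\<^sup>2 - M\<^sup>2) * S x) (at x within X)"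
    and dS: "(S has_real_derivative C x) (at x within X)"
    and unit: "(C x)\<^sup>2 - (r\<^sup>2 - M\<^sup>2) * (S x)\<^sup>2 = 1"
    and w1: "(w1 has_real_derivative (C x + r * S x) * F1 x - M * S x * F2 x) (at x within X)"
    and w2: "(w2 has_real_derivative M * S x * F1 x + (C x - r * S x) * F2 x) (at x within X)"
  shows "(u1 has_real_derivative - r * u1 x + M * u2 x + F1 x) (at x within X)"
    and "(u2 has_real_derivative - M * u1 x + r * u2 x + F2 x) (at x within X)"
proof -
  have "F1 x = F1 x * ((C x)\<^sup>2 - (r\<^sup>2 - M\<^sup>2) * (S x)\<^sup>2)" "F2 x = F2 x * ((C x)\<^sup>2 - (r\<^sup>2 - M\<^sup>2) * (S x)\<^sup>2)"
    using unit by simp_all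
  note F = this
  have "(u1 has_real_derivative ((r\<^sup>2 - M\<^sup>2) * S x - r * C x) * w1 x
      + ((C x + r * S x) * F1 x - M * S x * F2 x) * (C x - r * S x)
      + (M * C x * w2 x + (M * S x * F1 x + (C x - r * S x) * F2 x) * (M * S x))) (at x within X)"
    unfolding u1_def by (intro DERIV_add DERIV_mult DERIV_diff DERIV_cmult assms)
  moreover have "((r\<^sup>2 - M\<^sup>2) * S x - r * C x) * w1 x
      + ((C x + r * S x) * F1 x - M * S x * F2 x) * (C x - r * S x)
      + (M * C x * w2 x + (M * S x * F1 x + (C x - r * S x) * F2 x) * (M * S x))
      = - r * u1 x + M * u2 x + F1 x * ((C x)\<^sup>2 - (r\<^sup>2 - M\<^sup>2) * (S x)\<^sup>2)"
    unfolding u1_def u2_def by (simp add: power2_eq_square algebra_simps)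
  ultimately show "(u1 has_real_derivative - r * u1 x + M * u2 x + F1 x) (at x within X)"
    using F(1) by simp
  have "(u2 has_real_derivative - M * C x * w1 x
      + ((C x + r * S x) * F1 x - M * S x * F2 x) * (- M * S x)
      + (((r\<^sup>2 - M\<^sup>2) * S x + r * C x) * w2 x
        + (M * S x * F1 x + (C x - r * S x) * F2 x) * (C x + r * S x))) (at x within X)"
    unfolding u2_def by (intro DERIV_add DERIV_mult DERIV_diff DERIV_cmult assms)
  moreover have "- M * C x * w1 x
      + ((C x + r * S x) * F1 x - M * S x * F2 x) * (- M * S x)
      + (((r\<^sup>2 - M\<^sup>2) * S x + r * C x) * w2 x
        + (M * S x * F1 x + (C x - r * S x) * F2 x) * (C x + r * S x))
      = - M * u1 x + r * u2 x + F2 x * ((C x)\<^sup>2 - (r\<^sup>2 - M\<^sup>2) * (S x)\<^sup>2)"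
    unfolding u1_def u2_def by (simp add: power2_eq_square algebra_simps)
  ultimately show "(u2 has_real_derivative - M * u1 x + r * u2 x + F2 x) (at x within X)"
    using F(2) by simp
qed

section \<open>Solvability of the implicit Euler step\<close>

lemma dual_energy_zero_imp_zero_at_left:
  assumes "continuous_on {0..L} f" "continuous_on {0..L} g" "dual_energy f g \<le> 0"
  shows "f 0 = 0"
proof -
  have "dual_energy f g = 0" using assms(3) dual_energy_nonneg[of f g] by linarith
  moreover have "0 \<le> (f x)\<^sup>2 / weight_plus x + (g x)\<^sup>2 / weight_minus x" if "x \<in> {0..L}" for x
    using weight_bounds[OF that] by simp
  ultimately have "(f 0)\<^sup>2 / weight_plus 0 + (g 0)\<^sup>2 / weight_minus 0 = 0"
    using integral_eq_0_iff[OF dual_energy_integrand_continuous[OF assms(1,2)] L_pos] L_pos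
    by (auto simp: dual_energy_def)
  moreover have "0 < weight_plus 0" "0 < weight_minus 0" using weight_bounds[of 0] L_pos by auto
  ultimately show ?thesis
    by (smt (verit) divide_nonneg_pos zero_le_power2 divide_eq_0_iff power_eq_0_iff)
qed

text \<open>With \<open>r = 1 / h\<close> the step is \<open>u' = B u + (r f, - r g)\<close> for the matrix \<open>B\<close> above. The
  condition at \<open>0\<close> leaves the multiples of the solution of the homogeneous equation
  starting at \<open>(1, k)\<close>, and the condition at \<open>L\<close> is one scalar equation for the factor. Its coefficient
  \<open>\<Delta>\<close> is not zero: otherwise the homogeneous solution would be a step from zero data,
  hence zero by contraction, although it starts at \<open>(1, k)\<close>. The restriction \<open>h M < 1\<close> makes
  \<open>r\<^sup>2 - M\<^sup>2\<close> positive, so that hyperbolic functions are the right ones.\<close>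
lemma implicit_step_exists:
  assumes h: "0 < h" "h * M < 1" and f: "continuous_on {0..L} f" and g: "continuous_on {0..L} g"
  shows "\<exists>\<phi> \<psi>. implicit_step h f g \<phi> \<psi>"
proof -
  define r \<mu> where "r = 1 / h" and "\<mu> = sqrt (r\<^sup>2 - M\<^sup>2)"
  define C S where "C x = cosh (\<mu> * x)" and "S x = sinh (\<mu> * x) / \<mu>" for x
  have "M < r" using h by (simp add: r_def field_simps)
  then have "M\<^sup>2 < r\<^sup>2" using M_pos by (intro power_strict_mono) auto
  then have mu: "\<mu> > 0" "\<mu>\<^sup>2 = r\<^sup>2 - M\<^sup>2" by (auto simp: \<mu>_def)
  have dC: "(C has_real_derivative (r\<^sup>2 - M\<^sup>2) * S x) (at x within X)" for x X
    unfolding C_def S_def mu(2)[symmetric] using mu(1)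
    by (auto intro!: derivative_eq_intros simp: power2_eq_square)
  have dS: "(S has_real_derivative C x) (at x within X)" for x X
    unfolding C_def S_def using mu(1)
    by (auto intro!: derivative_eq_intros)
  have unit: "(C x)\<^sup>2 - (r\<^sup>2 - M\<^sup>2) * (S x)\<^sup>2 = 1" for x
    unfolding C_def S_def mu(2)[symmetric] using mu(1)
    by (simp add: power_divide hyperbolic_pythagoras)
  have cC: "continuous_on X C" and cS: "continuous_on X S" for X
    unfolding C_def S_def using mu(1) by (auto intro!: continuous_intros)
  have C0: "C 0 = 1" and S0: "S 0 = 0" by (simp_all add: C_def S_def)
  define e1 e2 where "e1 x = (C x + r * S x) * (r * f x) - M * S x * (- r * g x)"
    and "e2 x = M * S x * (r * f x) + (C x - r * S x) * (- r * g x)" for x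
  have ce: "continuous_on {0..L} e1" "continuous_on {0..L} e2"
    unfolding e1_def e2_def by (intro continuous_intros cC cS f g)+
  \<comment> \<open>The two components of \<open>exp (x B) (w1, w2)\<close>.\<close>
  define U1 where "U1 w1 w2 x = (C x - r * S x) * w1 x + M * S x * w2 x" for w1 w2 :: "real \<Rightarrow> real" and x
  define U2 where "U2 w1 w2 x = - M * S x * w1 x + (C x + r * S x) * w2 x" for w1 w2 :: "real \<Rightarrow> real" and x
  have step: "implicit_step h F G (U1 w1 w2) (U2 w1 w2)"
    if w1: "\<And>x. x \<in> {0..L} \<Longrightarrow> (w1 has_real_derivative
          (C x + r * S x) * (r * F x) - M * S x * (- r * G x)) (at x within {0..L})"
      and w2: "\<And>x. x \<in> {0..L} \<Longrightarrow> (w2 has_real_derivative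
          M * S x * (r * F x) + (C x - r * S x) * (- r * G x)) (at x within {0..L})"
      and FG: "continuous_on {0..L} F" "continuous_on {0..L} G"
      and bc: "U1 w1 w2 L = U2 w1 w2 L" "w2 0 = k * w1 0"
    for F G w1 w2
  proof -
    have d: "(U1 w1 w2 has_real_derivative - r * U1 w1 w2 x + M * U2 w1 w2 x + r * F x) (at x within {0..L})"
       "(U2 w1 w2 has_real_derivative - M * U1 w1 w2 x + r * U2 w1 w2 x + - r * G x) (at x within {0..L})"
      if "x \<in> {0..L}" for x
      unfolding U1_def[abs_def] U2_def[abs_def]
      using exponential_variation_of_constants[where C = C and S = S and r = r and ?w1.0 = w1
          and ?w2.0 = w2 and ?F1.0 = "\<lambda>x. r * F x" and ?F2.0 = "\<lambda>x. - r * G x",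
          OF dC dS unit w1[OF that] w2[OF that]]
      by simp_all
    have cU: "continuous_on {0..L} (U1 w1 w2)" "continuous_on {0..L} (U2 w1 w2)"
      by (rule DERIV_continuous_on[OF d(1)], assumption, rule DERIV_continuous_on[OF d(2)], assumption)
    have hr: "h * r = 1" using h by (simp add: r_def)
    have hr': "h * (r * z) = z" for z using hr by (simp add: mult.assoc[symmetric])
    show ?thesis
      unfolding implicit_step_def
    proof (intro exI conjI ballI)
      fix x assume x: "x \<in> {0..L}"
      show "(U1 w1 w2 has_real_derivative - r * U1 w1 w2 x + M * U2 w1 w2 x + r * F x) (at x within {0..L})"
        using d(1)[OF x] .
      show "(U2 w1 w2 has_real_derivative - M * U1 w1 w2 x + r * U2 w1 w2 x + - r * G x) (at x within {0..L})"
        using d(2)[OF x] .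
      show "U1 w1 w2 x - h * (- (- r * U1 w1 w2 x + M * U2 w1 w2 x + r * F x) + M * U2 w1 w2 x) = F x"
        by (simp add: algebra_simps hr')
      show "U2 w1 w2 x - h * (- M * U1 w1 w2 x + r * U2 w1 w2 x + - r * G x + M * U1 w1 w2 x) = G x"
        by (simp add: algebra_simps hr')
    next
      show "continuous_on {0..L} (\<lambda>x. - r * U1 w1 w2 x + M * U2 w1 w2 x + r * F x)"
        "continuous_on {0..L} (\<lambda>x. - M * U1 w1 w2 x + r * U2 w1 w2 x + - r * G x)"
        by (intro continuous_intros cU FG)+
      show "U1 w1 w2 L = U2 w1 w2 L" by (rule bc)
      show "U2 w1 w2 0 = k * U1 w1 w2 0" using bc(2) by (simp add: U1_def U2_def C0 S0)
    qed
  qed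
  \<comment> \<open>\<open>(e1, e2)\<close> is \<open>exp (- x B) (r f, - r g)\<close>; its primitive \<open>(I1, I2)\<close> gives the particular
     solution that vanishes at \<open>0\<close>.\<close>
  define I1 I2 where "I1 x = integral {0..x} e1" and "I2 x = integral {0..x} e2" for x
  have dI: "(I1 has_real_derivative e1 x) (at x within {0..L})"
    "(I2 has_real_derivative e2 x) (at x within {0..L})" if "x \<in> {0..L}" for x
    unfolding I1_def I2_def using ce that by (auto intro!: integral_has_real_derivative)
  have I0: "I1 0 = 0" "I2 0 = 0" by (simp_all add: I1_def I2_def)
  define \<Delta> where "\<Delta> = U1 (\<lambda>x. 1) (\<lambda>x. k) L - U2 (\<lambda>x. 1) (\<lambda>x. k) L"
  have "\<Delta> \<noteq> 0"
  proof
    assume "\<Delta> = 0"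
    then have *: "implicit_step h (\<lambda>x. 0) (\<lambda>x. 0) (U1 (\<lambda>x. 1) (\<lambda>x. k)) (U2 (\<lambda>x. 1) (\<lambda>x. k))"
      by (intro step) (auto simp: \<Delta>_def)
    then have "dual_energy (U1 (\<lambda>x. 1) (\<lambda>x. k)) (U2 (\<lambda>x. 1) (\<lambda>x. k)) \<le> dual_energy (\<lambda>x. 0) (\<lambda>x. 0)"
      using h by (intro implicit_step_contraction)
    then have "U1 (\<lambda>x. 1) (\<lambda>x. k) 0 = 0"
      using implicit_step_continuous[OF *] by (intro dual_energy_zero_imp_zero_at_left) (auto simp: dual_energy_def)
    then show False by (simp add: U1_def C0 S0)
  qed
  define c where "c = - (U1 I1 I2 L - U2 I1 I2 L) / \<Delta>"
  have "implicit_step h f g (U1 (\<lambda>x. c + I1 x) (\<lambda>x. c * k + I2 x)) (U2 (\<lambda>x. c + I1 x) (\<lambda>x. c * k + I2 x))"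
  proof (rule step)
    fix x assume x: "x \<in> {0..L}"
    show "((\<lambda>x. c + I1 x) has_real_derivative (C x + r * S x) * (r * f x) - M * S x * (- r * g x)) (at x within {0..L})"
      using DERIV_add[OF DERIV_const dI(1)[OF x], of c] by (simp add: e1_def)
    show "((\<lambda>x. c * k + I2 x) has_real_derivative M * S x * (r * f x) + (C x - r * S x) * (- r * g x)) (at x within {0..L})"
      using DERIV_add[OF DERIV_const dI(2)[OF x], of "c * k"] by (simp add: e2_def)
  next
    have "U1 (\<lambda>x. c + I1 x) (\<lambda>x. c * k + I2 x) L - U2 (\<lambda>x. c + I1 x) (\<lambda>x. c * k + I2 x) L
        = c * \<Delta> + (U1 I1 I2 L - U2 I1 I2 L)"
      unfolding \<Delta>_def U1_def U2_def by (simp add: algebra_simps)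
    also have "\<dots> = 0" using \<open>\<Delta> \<noteq> 0\<close> by (simp add: c_def)
    finally show "U1 (\<lambda>x. c + I1 x) (\<lambda>x. c * k + I2 x) L = U2 (\<lambda>x. c + I1 x) (\<lambda>x. c * k + I2 x) L"
      by simp
  qed (use I0 f g in auto)
  then show ?thesis by blast
qed

lemma implicit_step_sequence:
  assumes h: "0 < h" "h * M < 1" and f: "continuous_on {0..L} f" and g: "continuous_on {0..L} g"
  obtains F G :: "nat \<Rightarrow> real \<Rightarrow> real" where "F 0 = f" "G 0 = g"
    and "\<And>n. implicit_step h (F n) (G n) (F (Suc n)) (G (Suc n))"
proof -
  have "\<exists>Y :: nat \<Rightarrow> (real \<Rightarrow> real) \<times> (real \<Rightarrow> real). \<forall>n.
      (continuous_on {0..L} (fst (Y n)) \<and> continuous_on {0..L} (snd (Y n)) \<and> (n = 0 \<longrightarrow> Y n = (f, g)))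
      \<and> implicit_step h (fst (Y n)) (snd (Y n)) (fst (Y (Suc n))) (snd (Y (Suc n)))"
  proof (rule dependent_nat_choice)
    show "\<exists>x. continuous_on {0..L} (fst x) \<and> continuous_on {0..L} (snd x) \<and> (0 = 0 \<longrightarrow> x = (f, g))"
      using f g by auto
  next
    fix Y :: "(real \<Rightarrow> real) \<times> (real \<Rightarrow> real)" and n :: nat
    assume "continuous_on {0..L} (fst Y) \<and> continuous_on {0..L} (snd Y) \<and> (n = 0 \<longrightarrow> Y = (f, g))"
    then obtain \<phi> \<psi> where *: "implicit_step h (fst Y) (snd Y) \<phi> \<psi>"
      using implicit_step_exists[OF h] by blast
    show "\<exists>Z. (continuous_on {0..L} (fst Z) \<and> continuous_on {0..L} (snd Z) \<and> (Suc n = 0 \<longrightarrow> Z = (f, g)))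
        \<and> implicit_step h (fst Y) (snd Y) (fst Z) (snd Z)"
      using * implicit_step_continuous[OF *] by (intro exI[of _ "(\<phi>, \<psi>)"]) auto
  qed
  then obtain Y :: "nat \<Rightarrow> (real \<Rightarrow> real) \<times> (real \<Rightarrow> real)" where
    "\<And>n. implicit_step h (fst (Y n)) (snd (Y n)) (fst (Y (Suc n))) (snd (Y (Suc n)))" "Y 0 = (f, g)"
    by blast
  then show ?thesis using that[of "\<lambda>n. fst (Y n)" "\<lambda>n. snd (Y n)"] by simp
qed

section \<open>Pairing a weak solution with implicit Euler iterates\<close>

text \<open>The equations say that \<open>y\<^sub>m(t) = y\<^sub>m\<^sub>+\<^sub>1(t) + h y\<^sub>m\<^sub>+\<^sub>1'(t)\<close> is the first-order Taylor
  approximation of \<open>y\<^sub>m\<^sub>+\<^sub>1(t + h)\<close>, and that \<open>h\<^sup>2\<close> times the second derivative of \<open>y\<^sub>m\<^sub>+\<^sub>2\<close> is the second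
  difference in the index. So a value is handed on along \<open>(m, t) \<mapsto> (m + 1, t + h)\<close> at a cost of
  \<open>h\<^sup>2 K\<close> per step. The start at index \<open>2\<close> leaves room for two earlier members of the sequence, whose
  second difference with \<open>y\<^sub>2\<close> can be computed from the datum.\<close>
lemma backward_euler_relay:
  fixes y :: "nat \<Rightarrow> real \<Rightarrow> real"
  assumes h: "h > 0"
    and deriv: "\<And>m t. 0 \<le> t \<Longrightarrow> t \<le> n * h \<Longrightarrow>
      (y (Suc m) has_real_derivative (y m t - y (Suc m) t) / h) (at t within {0..n * h})"
    and bound: "\<And>m t. 0 \<le> t \<Longrightarrow> t \<le> n * h \<Longrightarrow>
      \<bar>y (m + 2) t - 2 * y (m + 1) t + y m t\<bar> \<le> h\<^sup>2 * K"
  shows "\<bar>y (n + 2) (n * h) - y 2 0\<bar> \<le> n * h\<^sup>2 * K"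
proof -
  have step: "\<bar>y (m + 2) (t + h) - y (m + 1) t\<bar> \<le> h\<^sup>2 * K"
    if t: "0 \<le> t" "t + h \<le> n * h" for m t
  proof -
    have sub: "{t..t + h} \<subseteq> {0..n * h}" using t by auto
    have D: "(y (Suc m) has_real_derivative (y m s - y (Suc m) s) / h) (at s within {t..t + h})"
      if "s \<in> {t..t + h}" for s m
      using deriv[of s m] that sub by (intro DERIV_subset[OF _ sub]) auto
    define d where "d s = (y (m + 1) s - y (m + 2) s) / h" for s
    have Dd: "(d has_real_derivative (y m s - 2 * y (m + 1) s + y (m + 2) s) / h\<^sup>2)
        (at s within {t..t + h})" if "s \<in> {t..t + h}" for s
    proof -
      have "(d has_real_derivative ((y m s - y (Suc m) s) / h - (y (Suc m) s - y (Suc (Suc m)) s) / h) / h)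
          (at s within {t..t + h})"
        unfolding d_def using DERIV_cdivide[OF DERIV_diff[OF D[OF that, of m] D[OF that, of "Suc m"]], of h]
        by simp
      moreover have "((y m s - y (Suc m) s) / h - (y (Suc m) s - y (Suc (Suc m)) s) / h) / h
          = (y m s - 2 * y (m + 1) s + y (m + 2) s) / h\<^sup>2"
        using h by (simp add: field_simps power2_eq_square)
      ultimately show ?thesis by simp
    qed
    obtain \<xi> where xi: "t < \<xi>" "\<xi> < t + h"
      and mv: "y (m + 2) (t + h) - y (m + 2) t = d \<xi> * h"
    proof -
      have "\<exists>\<xi>\<in>{t<..<t + h}. y (m + 2) (t + h) - y (m + 2) t = (\<lambda>v. v * d \<xi>) (t + h - t)"
      proof (rule mvt_simple)
        show "(y (m + 2) has_derivative (\<lambda>v. v * d s)) (at s within {t..t + h})"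
          if "t \<le> s" "s \<le> t + h" for s
        proof -
          have "(\<lambda>v. v * d s) = (*) (d s)" by (auto simp: mult.commute)
          then show ?thesis
            using D[of s "Suc m"] that by (simp add: d_def has_field_derivative_def)
        qed
      qed (use h in auto)
      then show ?thesis using that by (auto simp: mult.commute)
    qed
    have "\<bar>d \<xi> - d t\<bar> \<le> K * \<bar>\<xi> - t\<bar>"
      unfolding real_norm_def[symmetric]
    proof (rule field_differentiable_bound)
      show "(d has_real_derivative (y m s - 2 * y (m + 1) s + y (m + 2) s) / h\<^sup>2)
        (at s within {t..t + h})" if "s \<in> {t..t + h}" for s using Dd[OF that] .
      show "norm ((y m s - 2 * y (m + 1) s + y (m + 2) s) / h\<^sup>2) \<le> K" if "s \<in> {t..t + h}" for s
        using bound[of s m] that sub h by (auto simp: field_simps)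
    qed (use xi in auto)
    moreover have "0 \<le> K"
      using bound[of t m] t h by (smt (verit) zero_le_mult_iff zero_less_power)
    ultimately have "\<bar>d \<xi> - d t\<bar> \<le> K * h"
      using xi by (smt (verit) mult_left_mono)
    moreover have "y (m + 2) (t + h) - y (m + 1) t = h * (d \<xi> - d t)"
    proof -
      have "h * d t = y (m + 1) t - y (m + 2) t" using h by (simp add: d_def)
      then show ?thesis using mv by (simp add: algebra_simps)
    qed
    ultimately show ?thesis
      using h by (simp add: abs_mult power2_eq_square mult.commute mult.assoc)
  qed
  have "\<bar>y (j + 2) (j * h) - y 2 0\<bar> \<le> j * h\<^sup>2 * K" if "j \<le> n" for j
    using that
  proof (induction j)
    case (Suc j)
    have "(j + 1) * h \<le> n * h" using Suc.prems h by (intro mult_right_mono) auto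
    then have "\<bar>y (j + 3) (j * h + h) - y (j + 2) (j * h)\<bar> \<le> h\<^sup>2 * K"
      using step[of "j * h" "j + 1"] h by (simp add: algebra_simps numeral_3_eq_3)
    moreover have "\<bar>y (j + 2) (j * h) - y 2 0\<bar> \<le> j * h\<^sup>2 * K"
      using Suc by simp
    ultimately show ?case
      by (simp add: algebra_simps numeral_3_eq_3)
  qed (simp add: numeral_2_eq_2)
  then show ?thesis by simp
qed

lemma weak_solution_initial_pairing:
  assumes ws: "weak_solution L M k p0 q0 p q" and l0: "L2 L p0" "L2 L q0"
    and l: "L2 L \<phi>" "L2 L \<psi>"
  shows "pairing L p0 q0 \<phi> \<psi> = pairing L (p 0) (q 0) \<phi> \<psi>"
proof -
  have "AE x in lebesgue_on {0<..<L}. p 0 x = p0 x \<and> q 0 x = q0 x"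
    using ws unfolding weak_solution_def by blast
  then have ae: "AE x in lebesgue_on {0<..<L}. p0 x = p 0 x" "AE x in lebesgue_on {0<..<L}. q0 x = q 0 x"
    by (auto elim: eventually_mono)
  show ?thesis
    unfolding pairing_def
    using L2_inner_cong[OF ae(1) l0(1) weak_solution_L2(1)[OF ws] l(1)]
      L2_inner_cong[OF ae(2) l0(2) weak_solution_L2(2)[OF ws] l(2)] by simp
qed

text \<open>The weak formulation is tested with functions that do not depend on time; then the
  integrand is \<open>- \<langle>u, A (\<phi>, \<psi>)\<rangle>\<close>, which the step equation turns into a difference quotient of
  pairings.\<close>
lemma weak_solution_pairing_integral:
  assumes ws: "weak_solution L M k p0 q0 p q" and l0: "L2 L p0" "L2 L q0"
    and step: "implicit_step h f g \<phi> \<psi>" and h: "h > 0" and T: "T \<ge> 0"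
  shows "pairing L (p T) (q T) \<phi> \<psi> = pairing L (p 0) (q 0) \<phi> \<psi> +
    integral {0..T} (\<lambda>t. (pairing L (p t) (q t) f g - pairing L (p t) (q t) \<phi> \<psi>) / h)"
proof (cases "T = 0")
  case False
  then have T: "T > 0" using T by simp
  obtain \<phi>' \<psi>' where d: "\<And>x. x \<in> {0..L} \<Longrightarrow> (\<phi> has_real_derivative \<phi>' x) (at x within {0..L})"
      "\<And>x. x \<in> {0..L} \<Longrightarrow> (\<psi> has_real_derivative \<psi>' x) (at x within {0..L})"
    and e: "\<And>x. x \<in> {0..L} \<Longrightarrow> \<phi> x - h * (- \<phi>' x + M * \<psi> x) = f x"
      "\<And>x. x \<in> {0..L} \<Longrightarrow> \<psi> x - h * (\<psi>' x + M * \<phi> x) = g x"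
    and c: "continuous_on {0..L} \<phi>'" "continuous_on {0..L} \<psi>'" and bc: "\<phi> L = \<psi> L" "\<psi> 0 = k * \<phi> 0"
    using step unfolding implicit_step_def by blast
  note L2s = implicit_step_continuous[OF step, THEN L2_continuous]
  let ?y = "\<lambda>t. pairing L (p t) (q t) \<phi> \<psi>" and ?z = "\<lambda>t. pairing L (p t) (q t) f g"
  let ?r = "\<lambda>t. L2_inner L (p t) (\<lambda>x. 0 + \<phi>' x - M * \<psi> x) + L2_inner L (q t) (\<lambda>x. 0 - \<psi>' x - M * \<phi> x)"
  have "L2_inner L (p T) \<phi> + L2_inner L (q T) \<psi> = L2_inner L p0 \<phi> + L2_inner L q0 \<psi> +
      integral\<^sup>L (lebesgue_on {0..T}) ?r"
    using ws[unfolded weak_solution_def, THEN conjunct2, THEN conjunct2, THEN conjunct2, rule_format,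
      of T "\<lambda>t. \<phi>" "\<lambda>t x. 0" "\<lambda>t. \<phi>'" "\<lambda>t. \<psi>" "\<lambda>t x. 0" "\<lambda>t. \<psi>'"] T bc
      C1_rect_constant_in_time[OF d(1) c(1)] C1_rect_constant_in_time[OF d(2) c(2)]
    by blast
  moreover have "L2_inner L p0 \<phi> + L2_inner L q0 \<psi> = ?y 0"
    using weak_solution_initial_pairing[OF ws l0 L2s(3,4)] by (simp add: pairing_def)
  moreover have "integral\<^sup>L (lebesgue_on {0..T}) ?r = integral\<^sup>L (lebesgue_on {0..T}) (\<lambda>t. (?z t - ?y t) / h)"
  proof (rule Bochner_Integration.integral_cong[OF refl])
    fix t assume "t \<in> space (lebesgue_on {0..T})"
    then have "t \<ge> 0" by simp
    note l = weak_solution_L2[OF ws this]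
    have "L2_inner L (p t) f = L2_inner L (p t) (\<lambda>x. \<phi> x + h * (0 + \<phi>' x - M * \<psi> x))"
      by (rule L2_inner_cong_right) (use e(1) in \<open>force simp: algebra_simps\<close>)
    also have "\<dots> = L2_inner L (p t) \<phi> + h * L2_inner L (p t) (\<lambda>x. 0 + \<phi>' x - M * \<psi> x)"
      by (intro L2_inner_linear_right l L2s L2_continuous continuous_intros c
          implicit_step_continuous[OF step])
    finally have 1: "L2_inner L (p t) f = L2_inner L (p t) \<phi> + h * L2_inner L (p t) (\<lambda>x. 0 + \<phi>' x - M * \<psi> x)" .
    have "L2_inner L (q t) g = L2_inner L (q t) (\<lambda>x. \<psi> x + h * (0 - \<psi>' x - M * \<phi> x))"
      by (rule L2_inner_cong_right) (use e(2) in \<open>force simp: algebra_simps\<close>)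
    also have "\<dots> = L2_inner L (q t) \<psi> + h * L2_inner L (q t) (\<lambda>x. 0 - \<psi>' x - M * \<phi> x)"
      by (intro L2_inner_linear_right l L2s L2_continuous continuous_intros c
          implicit_step_continuous[OF step])
    finally have 2: "L2_inner L (q t) g = L2_inner L (q t) \<psi> + h * L2_inner L (q t) (\<lambda>x. 0 - \<psi>' x - M * \<phi> x)" .
    have "?z t - ?y t = h * ?r t"
      unfolding pairing_def 1 2 by (simp only: algebra_simps)
    then show "?r t = (?z t - ?y t) / h" using h by simp
  qed
  moreover have "integral\<^sup>L (lebesgue_on {0..T}) (\<lambda>t. (?z t - ?y t) / h) = integral {0..T} (\<lambda>t. (?z t - ?y t) / h)"
  proof (rule lebesgue_integral_eq_integral[OF continuous_imp_integrable_real])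
    have "continuous_on {0..} (\<lambda>t. (?z t - ?y t) / h)"
      using h by (intro continuous_intros weak_solution_pairing_continuous[OF ws] L2s) auto
    then show "continuous_on {0..T} (\<lambda>t. (?z t - ?y t) / h)"
      by (rule continuous_on_subset) auto
  qed simp
  ultimately show ?thesis unfolding pairing_def by linarith
qed simp

lemma weak_solution_pairing_derivative:
  assumes ws: "weak_solution L M k p0 q0 p q" and l0: "L2 L p0" "L2 L q0"
    and step: "implicit_step h f g \<phi> \<psi>" and h: "h > 0" and t: "t \<in> {0..T}"
  shows "((\<lambda>t. pairing L (p t) (q t) \<phi> \<psi>) has_real_derivative
    (pairing L (p t) (q t) f g - pairing L (p t) (q t) \<phi> \<psi>) / h) (at t within {0..T})"
proof -
  let ?r = "\<lambda>t. (pairing L (p t) (q t) f g - pairing L (p t) (q t) \<phi> \<psi>) / h"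
  have "continuous_on {0..} ?r"
    using h by (intro continuous_intros weak_solution_pairing_continuous[OF ws]
        L2_continuous implicit_step_continuous[OF step]) auto
  then have "continuous_on {0..T} ?r" by (rule continuous_on_subset) auto
  from DERIV_add[OF DERIV_const integral_has_real_derivative[OF this t]]
  have "((\<lambda>t. pairing L (p 0) (q 0) \<phi> \<psi> + integral {0..t} ?r) has_real_derivative ?r t) (at t within {0..T})"
    by simp
  then show ?thesis
  proof (rule has_field_derivative_transform_within[OF _ zero_less_one t])
    fix s assume "s \<in> {0..T}"
    then show "pairing L (p 0) (q 0) \<phi> \<psi> + integral {0..s} ?r = pairing L (p s) (q s) \<phi> \<psi>"
      using weak_solution_pairing_integral[OF ws l0 step h, of s] by simp
  qed
qed

lemma pairing_bound:
  assumes ws: "weak_solution L M k p0 q0 p q" and t: "t \<ge> 0"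
    and c: "continuous_on {0..L} \<phi>" "continuous_on {0..L} \<psi>" and w: "dual_energy \<phi> \<psi> \<le> w"
  shows "\<bar>pairing L (p t) (q t) \<phi> \<psi>\<bar> \<le> L2_norm2 L (p t) (q t) * sqrt (2 * w)"
proof -
  have "\<bar>pairing L (p t) (q t) \<phi> \<psi>\<bar> \<le> L2_norm2 L (p t) (q t) * L2_norm2 L \<phi> \<psi>"
    unfolding pairing_def by (intro L2_Cauchy_Schwarz weak_solution_L2[OF ws t] L2_continuous c)
  also have "L2_norm2 L \<phi> \<psi> \<le> sqrt (2 * w)"
    using L2_norm2_le_dual_energy[OF c] w by (smt (verit) real_sqrt_le_mono)
  finally show ?thesis using L2_norm2_nonneg[of L "p t" "q t"] by (simp add: mult_left_mono)
qed

section \<open>Implicit Euler iterates of regular dual data\<close>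

text \<open>A pair of such components lies in the domain of \<open>A\<^sup>2\<close> for every \<open>k\<close>, because all
  boundary values of the pair and of its image under \<open>A\<close> vanish.\<close>
definition admissible :: "(real \<Rightarrow> real) \<Rightarrow> (real \<Rightarrow> real) \<Rightarrow> (real \<Rightarrow> real) \<Rightarrow> bool" where
  "admissible \<phi> \<phi>' \<phi>'' \<longleftrightarrow>
     (\<forall>x. (\<phi> has_real_derivative \<phi>' x) (at x) \<and> (\<phi>' has_real_derivative \<phi>'' x) (at x)) \<and>
     continuous_on UNIV \<phi>'' \<and> \<phi> 0 = 0 \<and> \<phi> L = 0 \<and> \<phi>' 0 = 0 \<and> \<phi>' L = 0"

lemma admissible_continuous:
  assumes "admissible \<phi> \<phi>' \<phi>''"
  shows "continuous_on X \<phi>"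
proof (rule DERIV_continuous_on)
  show "(\<phi> has_real_derivative \<phi>' x) (at x within X)" for x
    using assms unfolding admissible_def by (blast intro: has_field_derivative_at_within)
qed

text \<open>The sequence is shifted so that the datum \<open>\<Phi> = (\<phi>, \<psi>)\<close> has index \<open>2\<close>: it is preceded by
  \<open>(1 - h A)\<^sup>2 \<Phi>\<close> and \<open>(1 - h A) \<Phi>\<close>, which exist as \<open>\<Phi>\<close> is in the domain of \<open>A\<^sup>2\<close>. Then the
  first second difference is exactly \<open>h\<^sup>2 A\<^sup>2 \<Phi>\<close>, with
  \<open>A\<^sup>2 (\<phi>, \<psi>) = (\<phi>'' + M\<^sup>2 \<phi>, \<psi>'' + M\<^sup>2 \<psi>)\<close>, and since second differences are themselves related
  by implicit steps, contraction carries the bound to all later ones.\<close>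
lemma implicit_sequence_through:
  assumes a: "admissible \<phi> \<phi>' \<phi>''" and b: "admissible \<psi> \<psi>' \<psi>''" and h: "0 < h" "h * M < 1"
  obtains F G :: "nat \<Rightarrow> real \<Rightarrow> real" where "F 2 = \<phi>" "G 2 = \<psi>"
    and "\<And>n. implicit_step h (F n) (G n) (F (Suc n)) (G (Suc n))"
    and "\<And>n. dual_energy (F (n + 2)) (G (n + 2)) \<le> dual_energy \<phi> \<psi>"
    and "\<And>n. dual_energy (\<lambda>x. F (n + 2) x - 2 * F (n + 1) x + F n x) (\<lambda>x. G (n + 2) x - 2 * G (n + 1) x + G n x)
          \<le> h ^ 4 * dual_energy (\<lambda>x. \<phi>'' x + M\<^sup>2 * \<phi> x) (\<lambda>x. \<psi>'' x + M\<^sup>2 * \<psi> x)"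
proof -
  define \<alpha> \<beta> where "\<alpha> x = - \<phi>' x + M * \<psi> x" and "\<beta> x = \<psi>' x + M * \<phi> x" for x
  define \<alpha>2 \<beta>2 where "\<alpha>2 x = \<phi>'' x + M\<^sup>2 * \<phi> x" and "\<beta>2 x = \<psi>'' x + M\<^sup>2 * \<psi> x" for x
  have d: "(\<phi> has_real_derivative \<phi>' x) (at x within X)" "(\<phi>' has_real_derivative \<phi>'' x) (at x within X)"
    "(\<psi> has_real_derivative \<psi>' x) (at x within X)" "(\<psi>' has_real_derivative \<psi>'' x) (at x within X)" for x X
    using a b unfolding admissible_def by (auto intro: has_field_derivative_at_within)
  have z: "\<phi> 0 = 0" "\<phi> L = 0" "\<phi>' 0 = 0" "\<phi>' L = 0" "\<psi> 0 = 0" "\<psi> L = 0" "\<psi>' 0 = 0" "\<psi>' L = 0"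
    using a b unfolding admissible_def by auto
  have c: "continuous_on X \<phi>" "continuous_on X \<phi>'" "continuous_on X \<psi>" "continuous_on X \<psi>'" for X
    using DERIV_continuous_on[OF d(1)] DERIV_continuous_on[OF d(2)]
      DERIV_continuous_on[OF d(3)] DERIV_continuous_on[OF d(4)] by auto
  have c2: "continuous_on X \<phi>''" "continuous_on X \<psi>''" for X
    using a b unfolding admissible_def by (auto intro: continuous_on_subset)
  have s1: "implicit_step h (\<lambda>x. \<phi> x - h * \<alpha> x) (\<lambda>x. \<psi> x - h * \<beta> x) \<phi> \<psi>"
    unfolding implicit_step_def \<alpha>_def \<beta>_def
  proof (rule exI[of _ \<phi>'], rule exI[of _ \<psi>'], intro conjI ballI)
    show "\<phi> L = \<psi> L" "\<psi> 0 = k * \<phi> 0" by (simp_all add: z)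
  qed (rule d c refl)+
  have s2: "implicit_step h (\<lambda>x. \<alpha> x - h * \<alpha>2 x) (\<lambda>x. \<beta> x - h * \<beta>2 x) \<alpha> \<beta>"
    unfolding implicit_step_def
  proof (rule exI[of _ "\<lambda>x. - \<phi>'' x + M * \<psi>' x"], rule exI[of _ "\<lambda>x. \<psi>'' x + M * \<phi>' x"],
      intro conjI ballI)
    show "(\<alpha> has_real_derivative - \<phi>'' x + M * \<psi>' x) (at x within {0..L})"
      "(\<beta> has_real_derivative \<psi>'' x + M * \<phi>' x) (at x within {0..L})" for x
      unfolding \<alpha>_def[abs_def] \<beta>_def[abs_def] by (intro DERIV_add DERIV_minus DERIV_cmult d)+
    show "\<alpha> x - h * (- (- \<phi>'' x + M * \<psi>' x) + M * \<beta> x) = \<alpha> x - h * \<alpha>2 x"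
      "\<beta> x - h * (\<psi>'' x + M * \<phi>' x + M * \<alpha> x) = \<beta> x - h * \<beta>2 x" for x
      by (simp_all add: \<alpha>_def \<beta>_def \<alpha>2_def \<beta>2_def algebra_simps power2_eq_square)
    show "continuous_on {0..L} (\<lambda>x. - \<phi>'' x + M * \<psi>' x)" "continuous_on {0..L} (\<lambda>x. \<psi>'' x + M * \<phi>' x)"
      by (intro continuous_intros c c2)+
  qed (simp_all add: \<alpha>_def \<beta>_def z)
  obtain F' G' :: "nat \<Rightarrow> real \<Rightarrow> real" where F'0: "F' 0 = \<phi>" "G' 0 = \<psi>"
    and F': "\<And>n. implicit_step h (F' n) (G' n) (F' (Suc n)) (G' (Suc n))"
    using implicit_step_sequence[OF h c(1) c(3)] by blast
  define F where "F n = (case n of 0 \<Rightarrow> (\<lambda>x. (\<phi> x - h * \<alpha> x) + (- h) * (\<alpha> x - h * \<alpha>2 x))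
    | Suc 0 \<Rightarrow> (\<lambda>x. \<phi> x - h * \<alpha> x) | Suc (Suc m) \<Rightarrow> F' m)" for n
  define G where "G n = (case n of 0 \<Rightarrow> (\<lambda>x. (\<psi> x - h * \<beta> x) + (- h) * (\<beta> x - h * \<beta>2 x))
    | Suc 0 \<Rightarrow> (\<lambda>x. \<psi> x - h * \<beta> x) | Suc (Suc m) \<Rightarrow> G' m)" for n
  have step: "implicit_step h (F n) (G n) (F (Suc n)) (G (Suc n))" for n
  proof -
    consider "n = 0" | "n = 1" | m where "n = Suc (Suc m)"
      by (metis One_nat_def not0_implies_Suc)
    then show ?thesis
    proof cases
      case 1
      then show ?thesis using implicit_step_linear[OF s1 s2, of "- h"] by (simp add: F_def G_def)
    next
      case 2
      then show ?thesis using s1 by (simp add: F_def G_def F'0)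
    next
      case 3
      then show ?thesis using F' by (simp add: F_def G_def)
    qed
  qed
  have F2: "F 2 = \<phi>" "G 2 = \<psi>" by (simp_all add: F_def G_def numeral_2_eq_2 F'0)
  define D where "D n x = F (n + 2) x - 2 * F (n + 1) x + F n x" for n x
  define E where "E n x = G (n + 2) x - 2 * G (n + 1) x + G n x" for n x
  have "implicit_step h (D n) (E n) (D (Suc n)) (E (Suc n))" for n
    using implicit_step_linear[OF implicit_step_linear[OF step[of "n + 2"] step[of "n + 1"], of "- 2"]
        step[of n], of 1]
    by (simp add: D_def[abs_def] E_def[abs_def])
  then have "dual_energy (D (Suc n)) (E (Suc n)) \<le> dual_energy (D n) (E n)" for n
    using h by (intro implicit_step_contraction)
  then have "dual_energy (D n) (E n) \<le> dual_energy (D 0) (E 0)" for n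
    by (induction n) (auto intro: order_trans)
  moreover have "D 0 = (\<lambda>x. h\<^sup>2 * \<alpha>2 x)" "E 0 = (\<lambda>x. h\<^sup>2 * \<beta>2 x)"
    unfolding D_def[abs_def] E_def[abs_def]
    using F2 by (simp_all add: fun_eq_iff) (simp_all add: F_def G_def F'0 algebra_simps power2_eq_square)
  ultimately have "dual_energy (D n) (E n) \<le> h ^ 4 * dual_energy \<alpha>2 \<beta>2" for n
    by (simp add: dual_energy_scale)
  moreover have "dual_energy (F (n + 2)) (G (n + 2)) \<le> dual_energy \<phi> \<psi>" for n
  proof (induction n)
    case (Suc n)
    have "dual_energy (F (Suc n + 2)) (G (Suc n + 2)) \<le> dual_energy (F (n + 2)) (G (n + 2))"
      using implicit_step_contraction[OF step[of "n + 2"] h(1)] by simp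
    then show ?case using Suc by simp
  qed (simp add: F_def G_def F'0)
  ultimately show ?thesis
    using that[OF F2 step] unfolding D_def E_def \<alpha>2_def[abs_def] \<beta>2_def[abs_def] by blast
qed

section \<open>Observability from the final state\<close>

text \<open>With \<open>h = T / n\<close> the \<open>n\<close> steps of the relay cost \<open>n h\<^sup>2 K = T\<^sup>2 K / n\<close>, where \<open>K\<close> is
  independent of \<open>n\<close>, and the iterate that meets \<open>u(T)\<close> has no more energy than the datum.\<close>
lemma weak_solution_observability:
  assumes ws: "weak_solution L M k p0 q0 p q" and l0: "L2 L p0" "L2 L q0" and T: "T > 0"
    and a: "admissible \<phi> \<phi>' \<phi>''" and b: "admissible \<psi> \<psi>' \<psi>''"
  shows "\<bar>pairing L p0 q0 \<phi> \<psi>\<bar> \<le> L2_norm2 L (p T) (q T) * sqrt (2 * dual_energy \<phi> \<psi>)"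
proof -
  define N where "N t = L2_norm2 L (p t) (q t)" for t
  have "continuous_on {0..T} N"
    unfolding N_def by (rule continuous_on_subset[OF weak_solution_norm_continuous[OF ws]]) auto
  then have "compact (N ` {0..T})" by (rule compact_continuous_image) simp
  then obtain B where B: "\<And>t. t \<in> {0..T} \<Longrightarrow> N t \<le> B"
    using bounded_imp_bdd_above[OF compact_imp_bounded, of "N ` {0..T}"] by (force simp: bdd_above_def)
  define W where "W = dual_energy (\<lambda>x. \<phi>'' x + M\<^sup>2 * \<phi> x) (\<lambda>x. \<psi>'' x + M\<^sup>2 * \<psi> x)"
  define K where "K = B * sqrt (2 * W)"
  have bound: "\<bar>pairing L (p 0) (q 0) \<phi> \<psi>\<bar> \<le> N T * sqrt (2 * dual_energy \<phi> \<psi>) + T\<^sup>2 * K / n"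
    if n: "n > 0" "T * M < n" for n :: nat
  proof -
    define h where "h = T / n"
    have h: "0 < h" "h * M < 1" "n * h = T" using n T by (auto simp: h_def field_simps)
    obtain F G :: "nat \<Rightarrow> real \<Rightarrow> real" where F2: "F 2 = \<phi>" "G 2 = \<psi>"
      and step: "\<And>n. implicit_step h (F n) (G n) (F (Suc n)) (G (Suc n))"
      and FW: "\<And>n. dual_energy (F (n + 2)) (G (n + 2)) \<le> dual_energy \<phi> \<psi>"
      and DW: "\<And>n. dual_energy (\<lambda>x. F (n + 2) x - 2 * F (n + 1) x + F n x)
          (\<lambda>x. G (n + 2) x - 2 * G (n + 1) x + G n x) \<le> h ^ 4 * W"
      using implicit_sequence_through[OF a b h(1,2), folded W_def] by blast
    note c = implicit_step_continuous[OF step]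
    define y where "y m t = pairing L (p t) (q t) (F m) (G m)" for m t
    have "\<bar>y (n + 2) (n * h) - y 2 0\<bar> \<le> n * h\<^sup>2 * K"
    proof (rule backward_euler_relay[OF h(1)])
      fix m t assume t: "0 \<le> t" "t \<le> real n * h"
      show "(y (Suc m) has_real_derivative (y m t - y (Suc m) t) / h) (at t within {0..real n * h})"
        unfolding y_def[abs_def] using t
        by (intro weak_solution_pairing_derivative[OF ws l0 step h(1)]) auto
      have l: "L2 L (p t)" "L2 L (q t)" using weak_solution_L2[OF ws] t by auto
      let ?D = "\<lambda>x. (F (m + 2) x + (- 2) * F (m + 1) x) + 1 * F m x"
      let ?E = "\<lambda>x. (G (m + 2) x + (- 2) * G (m + 1) x) + 1 * G m x"
      have "pairing L (p t) (q t) ?D ?E = y (m + 2) t - 2 * y (m + 1) t + y m t"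
      proof -
        have lc: "L2 L (F j)" "L2 L (G j)" for j using c by (auto intro: L2_continuous)
        have "pairing L (p t) (q t) ?D ?E
            = pairing L (p t) (q t) (\<lambda>x. F (m + 2) x + (- 2) * F (m + 1) x)
                (\<lambda>x. G (m + 2) x + (- 2) * G (m + 1) x) + 1 * y m t"
          unfolding y_def by (intro pairing_linear_right l lc L2_linear)
        also have "pairing L (p t) (q t) (\<lambda>x. F (m + 2) x + (- 2) * F (m + 1) x)
                (\<lambda>x. G (m + 2) x + (- 2) * G (m + 1) x) = y (m + 2) t + (- 2) * y (m + 1) t"
          unfolding y_def by (intro pairing_linear_right l lc)
        finally show ?thesis by simp
      qed
      moreover have "\<bar>pairing L (p t) (q t) ?D ?E\<bar> \<le> L2_norm2 L (p t) (q t) * sqrt (2 * (h ^ 4 * W))"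
        using DW[of m] by (intro pairing_bound[OF ws t(1)] continuous_intros c) auto
      moreover have "sqrt (2 * (h ^ 4 * W)) = h\<^sup>2 * sqrt (2 * W)"
      proof -
        have "h ^ 4 = (h\<^sup>2)\<^sup>2" by simp
        then have "sqrt (h ^ 4) = h\<^sup>2" by (simp only: real_sqrt_abs) simp
        then show ?thesis by (simp add: real_sqrt_mult)
      qed
      moreover have "L2_norm2 L (p t) (q t) * (h\<^sup>2 * sqrt (2 * W)) \<le> B * (h\<^sup>2 * sqrt (2 * W))"
        using B[of t] t h(3) dual_energy_nonneg unfolding N_def W_def by (intro mult_right_mono) auto
      ultimately show "\<bar>y (m + 2) t - 2 * y (m + 1) t + y m t\<bar> \<le> h\<^sup>2 * K"
        unfolding K_def by (simp add: mult_ac)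
    qed
    moreover have "\<bar>y (n + 2) T\<bar> \<le> N T * sqrt (2 * dual_energy \<phi> \<psi>)"
      unfolding y_def N_def using T FW c by (intro pairing_bound[OF ws]) auto
    moreover have "n * h\<^sup>2 * K = T\<^sup>2 * K / n"
      using n by (simp add: h_def power2_eq_square)
    ultimately show ?thesis
      unfolding h(3) by (simp add: y_def F2)
  qed
  have "(\<lambda>n. N T * sqrt (2 * dual_energy \<phi> \<psi>) + T\<^sup>2 * K / real n) \<longlonglongrightarrow> N T * sqrt (2 * dual_energy \<phi> \<psi>) + 0"
    by (intro tendsto_intros tendsto_divide_0[OF tendsto_const] filterlim_compose[OF filterlim_at_top_imp_at_infinity filterlim_real_sequentially] filterlim_ident)
  moreover have "eventually (\<lambda>n. \<bar>pairing L (p 0) (q 0) \<phi> \<psi>\<bar> \<le> N T * sqrt (2 * dual_energy \<phi> \<psi>) + T\<^sup>2 * K / real n) sequentially"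
  proof -
    obtain n0 :: nat where "T * M < n0" using reals_Archimedean2 by blast
    then show ?thesis
      by (auto intro!: eventually_sequentiallyI[of "max 1 n0"] bound)
  qed
  ultimately have "\<bar>pairing L (p 0) (q 0) \<phi> \<psi>\<bar> \<le> N T * sqrt (2 * dual_energy \<phi> \<psi>) + 0"
    by (rule tendsto_lowerbound) simp
  moreover have "L2 L \<phi>" "L2 L \<psi>"
    by (intro L2_continuous admissible_continuous[OF a] admissible_continuous[OF b])+
  ultimately show ?thesis
    using weak_solution_initial_pairing[OF ws l0] by (simp add: N_def)
qed

text \<open>The factor \<open>(x (L - x))\<^sup>2\<close> enforces the boundary values and vanishes nowhere in \<open>(0,L)\<close>, so it
  loses no information when functions are tested against such polynomials.\<close>
lemma polynomial_double_zero_admissible: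
  assumes "real_polynomial_function P"
  obtains \<phi>' \<phi>'' where "admissible (\<lambda>x. (x * (L - x))\<^sup>2 * P x) \<phi>' \<phi>''"
proof -
  obtain P' where P': "real_polynomial_function P'" "\<And>x. (P has_real_derivative P' x) (at x)"
    using has_real_derivative_polynomial_function[OF assms] by blast
  define \<phi>' where "\<phi>' x = (x * (L - x)) * (2 * (L - 2 * x) * P x + x * (L - x) * P' x)" for x
  have poly: "real_polynomial_function \<phi>'"
    unfolding \<phi>'_def[abs_def]
    by (intro real_polynomial_function.intros(2-4) real_polynomial_function_diff assms P'(1)
        real_polynomial_function.intros(1)[OF bounded_linear_ident])
  obtain \<phi>'' where p: "real_polynomial_function \<phi>''" "\<And>x. (\<phi>' has_real_derivative \<phi>'' x) (at x)"
    using has_real_derivative_polynomial_function[OF poly] by blast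
  have "((\<lambda>x. (x * (L - x))\<^sup>2 * P x) has_real_derivative \<phi>' x) (at x)" for x
    unfolding \<phi>'_def
    by (auto intro!: derivative_eq_intros P'(2)) (simp add: power2_eq_square algebra_simps)
  moreover have "continuous_on UNIV \<phi>''"
    using p(1) by (simp add: continuous_on_polymonial_function real_polynomial_function_eq)
  ultimately have "admissible (\<lambda>x. (x * (L - x))\<^sup>2 * P x) \<phi>' \<phi>''"
    using p(2) by (simp add: admissible_def \<phi>'_def)
  then show ?thesis by (rule that)
qed

lemma exists_admissible_not_orthogonal:
  assumes f: "L2 L f" and nz: "\<not> (AE x in lebesgue_on {0<..<L}. f x = 0)"
  obtains \<phi> \<phi>' \<phi>'' where "admissible \<phi> \<phi>' \<phi>''" "L2_inner L f \<phi> \<noteq> 0"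
proof -
  let ?w = "\<lambda>x. (x * (L - x))\<^sup>2"
  have int: "integrable (lebesgue_on {0<..<L}) (\<lambda>x. f x * ?w x)"
    by (intro L2_mult_integrable f L2_continuous continuous_intros)
  have "\<not> (AE x in lebesgue_on {0<..<L}. f x * ?w x = 0)"
  proof
    assume "AE x in lebesgue_on {0<..<L}. f x * ?w x = 0"
    then have "AE x in lebesgue_on {0<..<L}. f x = 0"
      using AE_space by eventually_elim auto
    then show False using nz by simp
  qed
  then obtain P where P: "real_polynomial_function P"
    and ne: "integral\<^sup>L (lebesgue_on {0<..<L}) (\<lambda>x. f x * ?w x * P x) \<noteq> 0"
    using exists_polynomial_not_orthogonal[OF int] by blast
  obtain \<phi>' \<phi>'' where "admissible (\<lambda>x. ?w x * P x) \<phi>' \<phi>''"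
    using polynomial_double_zero_admissible[OF P] by blast
  then show ?thesis using that ne by (simp add: L2_inner_def mult.assoc)
qed

lemma admissible_zero: "admissible (\<lambda>x. 0) (\<lambda>x. 0) (\<lambda>x. 0)"
  by (simp add: admissible_def)

end

theorem proposition4:
  fixes L M k :: real and p0 q0 :: "real \<Rightarrow> real"
  assumes "L > 0" and "M > 0"
    and "M * L < 1 / 2"
    and "k\<^sup>2 \<ge> (1 + 2 * M * L) / (1 - 2 * M * L)"
    and "H1 L p0" and "H1 L q0"
    and "\<not> (AE x in lebesgue_on {0<..<L}. p0 x = 0 \<and> q0 x = 0)"
  shows "unstable_for L M k p0 q0"
proof -
  interpret dual_feedback_system L M k
    using assms(1-4) by unfold_locales
  have l0: "L2 L p0" "L2 L q0" using assms(5,6) by (auto simp: H1_def)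
  have "\<not> (AE x in lebesgue_on {0<..<L}. p0 x = 0) \<or> \<not> (AE x in lebesgue_on {0<..<L}. q0 x = 0)"
    using assms(7) by (auto simp: AE_conj_iff)
  then obtain \<phi> \<phi>' \<phi>'' \<psi> \<psi>' \<psi>'' where a: "admissible \<phi> \<phi>' \<phi>''" and b: "admissible \<psi> \<psi>' \<psi>''"
    and ne: "pairing L p0 q0 \<phi> \<psi> \<noteq> 0"
  proof
    assume "\<not> (AE x in lebesgue_on {0<..<L}. p0 x = 0)"
    then obtain \<phi> \<phi>' \<phi>'' where "admissible \<phi> \<phi>' \<phi>''" "L2_inner L p0 \<phi> \<noteq> 0"
      using exists_admissible_not_orthogonal[OF l0(1)] by blast
    then show ?thesis
      using that[OF _ admissible_zero] by (simp add: pairing_def L2_inner_def)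
  next
    assume "\<not> (AE x in lebesgue_on {0<..<L}. q0 x = 0)"
    then obtain \<phi> \<phi>' \<phi>'' where "admissible \<phi> \<phi>' \<phi>''" "L2_inner L q0 \<phi> \<noteq> 0"
      using exists_admissible_not_orthogonal[OF l0(2)] by blast
    then show ?thesis
      using that[OF admissible_zero] by (simp add: pairing_def L2_inner_def)
  qed
  show ?thesis
    unfolding unstable_for_def
  proof (intro allI impI notI)
    fix p q
    assume ws: "weak_solution L M k p0 q0 p q"
      and lim: "((\<lambda>t. L2_norm2 L (p t) (q t)) \<longlongrightarrow> 0) at_top"
    have "((\<lambda>t. L2_norm2 L (p t) (q t) * sqrt (2 * dual_energy \<phi> \<psi>)) \<longlongrightarrow> 0) at_top"
      using tendsto_mult_right[OF lim, of "sqrt (2 * dual_energy \<phi> \<psi>)"] by simp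
    moreover have "eventually (\<lambda>T. \<bar>pairing L p0 q0 \<phi> \<psi>\<bar> \<le> L2_norm2 L (p T) (q T) * sqrt (2 * dual_energy \<phi> \<psi>)) at_top"
      using eventually_gt_at_top[of 0]
      by eventually_elim (rule weak_solution_observability[OF ws l0 _ a b])
    ultimately have "\<bar>pairing L p0 q0 \<phi> \<psi>\<bar> \<le> 0"
      by (rule tendsto_lowerbound) simp
    then show False using ne by simp
  qed
qed

end
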